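(* For $\varphi,\theta\in[0,2\pi)$ let $K_1(t,\varphi,\theta)$ be the function of $t$ given by $$K_1(t,\varphi,\theta)=\frac{1}{2\pi}+\frac{1}{2\pi}\sum_{n\in\mathbb{Z}\setminus\{0\}}e^{in(\varphi-\theta)}e^{-2\lambda_{|n|}t},\qquad \lambda_n=2\sum_{j=0}^{n-1}\frac{1}{2j+1},$$ for $\operatorname{Re}(t)>\tfrac12$ if $\varphi=\theta$ and for $\operatorname{Re}(t)>0$ if $\varphi\ne\theta$. Then: (a) For each $\varphi,\theta\in[0,2\pi)$ with $\varphi\neq\theta$, $K_1(t,\varphi,\theta)$ extends to an entire function of $t$. (b) For each $\varphi\in[0,2\pi)$, $K_1(t,\varphi,\varphi)$ extends to a meromorphic function of $t\in\mathbb{C}$ with a simple pole at $t=\tfrac12$ and possible simple poles at $t=\tfrac12-m$, $m\in\mathbb{N}$ (i.e. each such point is either a simple pole or a regular point, and there are no other poles), with corresponding residues $$\frac{e^{-2\ln(2)-\gamma_E}}{2\pi}\,e^{[4\ln(2)+2\gamma_E]m}\,p_{2m,S_1}\big(\tfrac12-m\big),\qquad m\in\mathbb{N}_0,$$ at $t=\tfrac12-m$, where $S_1=\{s^{(1)}_k\}_{k\in\mathbb{N}}$ is the sequence $$s^{(1)}_k=(1-2^{1-k})\frac{2B_k}{k}=-\frac{2}{k}B_k(1/2),\qquad k\in\mathbb{N}.$$ (c) In particular, $t=0$ is a regular point of $K_1(t,\varphi,\theta)$ for all $\varphi,\theta\in[0,2\pi)$.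
   Context: $\mathbb{N}=\{1,2,\dots\}$, $\mathbb{N}_0=\mathbb{N}\cup\{0\}$; $\gamma_E$ is the Euler–Mascheroni constant; $B_k(s)$ are the Bernoulli polynomials and $B_k=B_k(0)$ the Bernoulli numbers, so $B_1=-1/2$. The empty sum gives $\lambda_0=0$; with $H_n=\sum_{k=1}^n 1/k$ one has $\lambda_n=2H_{2n}-H_n$. $K_1$ is (the spectral series of) the fundamental solution of $\partial_t u=-A_1u$, where, with $C$ the unit circle in the plane, $A_1h(y)=-\int_C\frac{h(z)-h(y)}{|z-y|}|dz|$, which has eigenpairs $A_1e^{\pm in\varphi}=2\lambda_ne^{\pm in\varphi}$, $n\in\mathbb{N}_0$. For a sequence of numbers $S=\{s_k\}$ indexed over a set containing $\mathbb{N}$ and $j\in\mathbb{N}_0$, $$p_{j,S}(t):=\sum_{k=0}^j\frac{(-1)^k}{k!}\widehat{B}_{j,k}(s_1,\dots,s_{j-k+1})\,t^k,$$ where $\widehat{B}_{n,k}$ are the partial ordinary Bell polynomials $$\widehat{B}_{n,k}(z_1,\dots,z_{n-k+1})=\sum\frac{k!}{j_1!j_2!\cdots j_{n-k+1}!}z_1^{j_1}\cdots z_{n-k+1}^{j_{n-k+1}},$$ the sum being over all nonnegative integers $j_1,\dots,j_{n-k+1}$ with $j_1+\cdots+j_{n-k+1}=k$ and $j_1+2j_2+\cdots+(n-k+1)j_{n-k+1}=n$ (so $\widehat B_{0,0}=1$ and $\widehat B_{n,0}=0$ for $n\ge1$). *)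

theory Defs
  imports "HOL-Complex_Analysis.Complex_Analysis"
begin

definition lam :: "nat \<Rightarrow> real" where
  "lam n = 2 * (\<Sum>j<n. 1 / (2 * real j + 1))"

definition K1_term :: "complex \<Rightarrow> real \<Rightarrow> real \<Rightarrow> int \<Rightarrow> complex" where
  "K1_term t \<phi> \<theta> n =
     exp (\<i> * of_int n * of_real (\<phi> - \<theta>)) * exp (- 2 * of_real (lam (nat \<bar>n\<bar>)) * t)"

text \<open>The series over the nonzero integers converges only conditionally for
  \<open>0 < Re t \<le> 1/2\<close>, so it cannot be an unordered sum. Convergence means that the series over
  the positive and over the negative integers both converge, equivalently that the partial sums
  over \<open>-M \<le> n \<le> N\<close> converge as \<open>M\<close> and \<open>N\<close> tend to infinity independently.\<close>

definition K1_convergent :: "complex \<Rightarrow> real \<Rightarrow> real \<Rightarrow> bool" where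
  "K1_convergent t \<phi> \<theta> \<longleftrightarrow>
     summable (\<lambda>n. K1_term t \<phi> \<theta> (int (Suc n))) \<and>
     summable (\<lambda>n. K1_term t \<phi> \<theta> (- int (Suc n)))"

definition K1 :: "complex \<Rightarrow> real \<Rightarrow> real \<Rightarrow> complex" where
  "K1 t \<phi> \<theta> = 1 / (2 * of_real pi) + 1 / (2 * of_real pi) *
     ((\<Sum>n. K1_term t \<phi> \<theta> (int (Suc n))) + (\<Sum>n. K1_term t \<phi> \<theta> (- int (Suc n))))"

text \<open>Bernoulli polynomials, from the generating function
  \<open>x e\<^sup>s\<^sup>x / (e\<^sup>x - 1) = (\<Sum>k. B\<^sub>k(s) x\<^sup>k / k!)\<close>.\<close>

definition bernoulli_poly :: "nat \<Rightarrow> real \<Rightarrow> real" where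
  "bernoulli_poly k s = fact k * fps_nth (fps_X * fps_exp s / (fps_exp 1 - 1)) k"

definition bernoulli_num :: "nat \<Rightarrow> real" where
  "bernoulli_num k = bernoulli_poly k 0"

text \<open>An exponent tuple \<open>(j\<^sub>1, \<dots>, j\<^sub>N)\<close> with \<open>N = n - k + 1\<close> is encoded as a function vanishing
  outside \<open>{1..N}\<close>; the set of such functions is finite because every entry is at most \<open>k\<close>.
  Only \<open>k \<le> n\<close> is meaningful.\<close>

definition bell_exponents :: "nat \<Rightarrow> nat \<Rightarrow> (nat \<Rightarrow> nat) set" where
  "bell_exponents n k =
     {j. (\<forall>i. i \<notin> {1..n - k + 1} \<longrightarrow> j i = 0) \<and>
         (\<Sum>i=1..n - k + 1. j i) = k \<and> (\<Sum>i=1..n - k + 1. i * j i) = n}"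

definition ordinary_bell :: "nat \<Rightarrow> nat \<Rightarrow> (nat \<Rightarrow> 'a) \<Rightarrow> 'a::field_char_0" where
  "ordinary_bell n k z =
     (\<Sum>j\<in>bell_exponents n k.
        fact k / (\<Prod>i=1..n - k + 1. fact (j i)) * (\<Prod>i=1..n - k + 1. z i ^ j i))"

definition p_poly :: "nat \<Rightarrow> (nat \<Rightarrow> 'a) \<Rightarrow> 'a \<Rightarrow> 'a::field_char_0" where
  "p_poly j S t = (\<Sum>k\<le>j. (- 1) ^ k / fact k * ordinary_bell j k S * t ^ k)"

text \<open>Only the values at \<open>k \<ge> 1\<close> are used.\<close>

definition S1 :: "nat \<Rightarrow> real" where
  "S1 k = (1 - 2 powi (1 - int k)) * (2 * bernoulli_num k / real k)"

definition is_simple_pole :: "(complex \<Rightarrow> complex) \<Rightarrow> complex \<Rightarrow> bool" where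
  "is_simple_pole f z \<longleftrightarrow> is_pole f z \<and> zorder f z = -1"

end

theory Submission
  imports Defs
begin

text \<open>
The theorem follows from an asymptotic expansion of the summands in powers of \<open>n\<close>. The
eigenvalues satisfy \<open>2 \<lambda>\<^sub>n = 2 ln n + 4 ln 2 + 2 \<gamma> + s\<^sub>1/n + s\<^sub>2/n\<^sup>2 + \<dots>\<close> asymptotically, and
exponentiating gives
\<open>e\<^bsup>- 2 \<lambda>\<^sub>n t\<^esup> = e\<^bsup>- (4 ln 2 + 2 \<gamma>) t\<^esup> (\<Sum>j\<le>J. p\<^sub>j(t) n\<^bsup>- 2 t - j\<^esup>) + O(n\<^bsup>- 2 Re t - J - 1\<^esup>)\<close>
uniformly for bounded \<open>t\<close> (\<open>exp_lam_expansion\<close>): the polynomials \<open>p\<^sub>j\<close> are by their definition through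
Bell polynomials the Taylor coefficients of \<open>exp (- t \<Sum>k. s\<^sub>k x\<^sup>k)\<close>. The sum of the remainders over \<open>n\<close>
is holomorphic for \<open>Re t > - J/2\<close>, and only the sums of pure powers have to be continued.

On the diagonal, these sums are \<open>p\<^sub>j(t) \<zeta>(2 t + j)\<close>, and the simple pole of \<open>\<zeta>\<close> at \<open>1\<close>
(\<open>zeta_continuation\<close>) produces at most a simple pole at \<open>t = (1 - j)/2\<close>. As \<open>s\<^sub>k = 0\<close> for odd
\<open>k\<close>, also \<open>p\<^sub>j = 0\<close> for odd \<open>j\<close>, so that only the points \<open>1/2 - m\<close> remain, where the residue of the
sum is half the value of the coefficient. It is nonzero for \<open>m = 0\<close> because \<open>p\<^sub>0 = 1\<close>. Off the diagonal, the sums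
are \<open>\<Sum>n. z\<^sup>n n\<^bsup>-s\<^esup>\<close> at \<open>s = 2 t + j\<close> with \<open>z = e\<^bsup>\<plusminus> i (\<phi> - \<theta>)\<^esup> \<noteq> 1\<close>, which continue to entire functions
(\<open>polylog_continuation\<close>). The point \<open>t = 0\<close> is not of the form \<open>1/2 - m\<close>, hence regular in both cases.

The expansion of the eigenvalues (\<open>lam_asymptotic_expansion\<close>) comes from a difference equation. The
recursion \<open>\<lambda>\<^sub>n\<^sub>+\<^sub>1 - \<lambda>\<^sub>n = 2 / (2 n + 1)\<close> determines the coefficients formally; that
they are the \<open>s\<^sub>k\<close> is an identity between Bernoulli polynomials at \<open>1/2\<close>. The additive constant of
\<open>\<lambda>\<^sub>n\<close> is the limit of \<open>2 H\<^sub>2\<^sub>n - H\<^sub>n - ln n\<close>. The continuations are obtained in the same spirit from the binomial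
expansion of \<open>(n + 1)\<^sup>a - n\<^sup>a\<close>. Since \<open>J\<close> is fixed in each step, every continuation is first obtained
on the half-planes \<open>Re t > - N\<close>, and \<open>half_plane_gluing\<close> joins them.
\<close>

section \<open>Bernoulli polynomials at one half\<close>

definition bernoulli_gf :: "real \<Rightarrow> real fps" where
  "bernoulli_gf s = fps_X * fps_exp s / (fps_exp 1 - 1)"

lemma bernoulli_poly_gf: "fps_nth (bernoulli_gf s) k = bernoulli_poly k s / fact k"
  by (simp add: bernoulli_poly_def bernoulli_gf_def)

text \<open>The constant term of \<open>e\<^sup>x - 1\<close> is \<open>0\<close>, so it is not invertible as a power series. The division is exact
because numerator and denominator both have subdegree 1. The identities for \<open>B\<^sub>k(1/2)\<close> are proved after
clearing this denominator.\<close>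

lemma bernoulli_gf_mult: "bernoulli_gf s * (fps_exp 1 - 1) = fps_X * fps_exp s"
proof -
  have "subdegree (fps_exp (1::real) - 1) = 1"
    by (rule subdegreeI) auto
  moreover have "fps_exp (1::real) - 1 \<noteq> 0"
    using calculation by auto
  moreover have "subdegree (fps_X * fps_exp s :: real fps) = 1"
    by (rule subdegreeI) auto
  ultimately have "(fps_exp (1::real) - 1) dvd (fps_X * fps_exp s)"
    by (subst fps_dvd_iff) auto
  thus ?thesis unfolding bernoulli_gf_def by (rule dvd_div_mult_self)
qed

lemma fps_exp_minus_1_nonzero: "fps_exp (1::real) - 1 \<noteq> 0"
proof
  assume "fps_exp (1::real) - 1 = 0"
  hence "fps_nth (fps_exp (1::real) - 1) 1 = 0" by simp
  thus False by simp
qed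

text \<open>Factoring \<open>e\<^sup>x - 1 = (e\<^bsup>x/2\<^esup> - 1) (e\<^bsup>x/2\<^esup> + 1)\<close> shows that the generating functions of
\<open>B\<^sub>k(1/2)\<close> and of \<open>B\<^sub>k\<close> add up to \<open>x / (e\<^bsup>x/2\<^esup> - 1)\<close>, which is twice the latter one evaluated at
\<open>x/2\<close>.\<close>

lemma bernoulli_poly_half: "bernoulli_poly k (1/2) = - (1 - 2 powi (1 - int k)) * bernoulli_num k"
proof -
  let ?B = "bernoulli_gf 0" and ?D = "fps_const (1/2) * fps_X :: real fps"
  have "(?B oo ?D) * ((fps_exp 1 - 1) oo ?D) = (fps_X * fps_exp 0) oo ?D"
    by (subst bernoulli_gf_mult[symmetric]) (rule fps_compose_mult_distrib[symmetric], simp)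
  hence half: "(?B oo ?D) * (fps_exp (1/2) - 1) = ?D"
    by (simp add: fps_compose_sub_distrib)
  have "fps_exp (1::real) = fps_exp (1/2) * fps_exp (1/2)"
    by (simp add: fps_exp_add_mult[symmetric])
  hence fac: "fps_exp (1::real) - 1 = (fps_exp (1/2) - 1) * (fps_exp (1/2) + 1)"
    by (simp add: algebra_simps)
  have "(bernoulli_gf (1/2) + ?B) * (fps_exp 1 - 1) = fps_X * (fps_exp (1/2) + 1)"
    by (simp add: distrib_right bernoulli_gf_mult distrib_left)
  also have "\<dots> = fps_const 2 * ?D * (fps_exp (1/2) + 1)"
    by (simp add: mult.assoc[symmetric])
  also have "\<dots> = (fps_const 2 * (?B oo ?D)) * (fps_exp 1 - 1)"
    by (subst half[symmetric], subst fac) (simp add: mult_ac)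
  finally have "bernoulli_gf (1/2) + ?B = fps_const 2 * (?B oo ?D)"
    using fps_exp_minus_1_nonzero by simp
  hence "fps_nth (bernoulli_gf (1/2) + ?B) k = fps_nth (fps_const 2 * (?B oo ?D)) k" by simp
  hence "bernoulli_poly k (1/2) / fact k + bernoulli_poly k 0 / fact k
      = 2 * ((1/2)^k * (bernoulli_poly k 0 / fact k))"
    by (simp add: bernoulli_poly_gf)
  hence "(bernoulli_poly k (1/2) + bernoulli_poly k 0) / fact k = 2 * (1/2)^k * bernoulli_poly k 0 / fact k"
    by (simp add: add_divide_distrib)
  hence "(bernoulli_poly k (1/2) + bernoulli_poly k 0) = 2 * (1/2)^k * bernoulli_poly k 0"
    by (simp only: divide_cancel_right fact_nonzero) simp
  moreover have "2 powi (1 - int k) = 2 * (1/2 :: real)^k"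
    by (simp add: power_int_diff power_one_over divide_simps)
  ultimately show ?thesis by (simp add: bernoulli_num_def algebra_simps)
qed

lemma S1_eq: "S1 k = - (2 / real k) * bernoulli_poly k (1 / 2)"
  unfolding S1_def bernoulli_poly_half by (simp add: algebra_simps flip: add_divide_distrib diff_divide_distrib)

text \<open>The generating function \<open>x e\<^bsup>x/2\<^esup> / (e\<^sup>x - 1) = (x/2) / sinh (x/2)\<close> is even.\<close>

lemma bernoulli_poly_half_odd:
  assumes "odd k" shows "bernoulli_poly k (1/2) = 0"
proof -
  let ?A = "bernoulli_gf (1/2)" and ?A' = "bernoulli_gf (1/2) oo - fps_X"
  have "?A' * ((fps_exp 1 - 1) oo - fps_X) = (fps_X * fps_exp (1/2)) oo - fps_X"
    by (subst bernoulli_gf_mult[symmetric]) (rule fps_compose_mult_distrib[symmetric], simp)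
  hence *: "?A' * (fps_exp (-1) - 1) = - fps_X * fps_exp (-1/2)"
    by (simp add: fps_compose_sub_distrib fps_compose_mult_distrib)
  have "?A' * (fps_exp (-1) - 1) * fps_exp 1 = - (?A' * (fps_exp 1 - 1))"
    by (simp add: algebra_simps fps_exp_add_mult[symmetric])
  moreover have "- fps_X * fps_exp (-1/2) * fps_exp 1 = - (fps_X * fps_exp (1/2) :: real fps)"
    by (simp add: mult.assoc fps_exp_add_mult[symmetric])
  ultimately have "?A' * (fps_exp 1 - 1) = ?A * (fps_exp 1 - 1)"
    using * by (simp add: bernoulli_gf_mult)
  hence "?A' = ?A" using fps_exp_minus_1_nonzero by simp
  hence "fps_nth ?A' k = fps_nth ?A k" by simp
  hence "(-1)^k * fps_nth ?A k = fps_nth ?A k" by (simp add: fps_compose_uminus')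
  thus ?thesis using assms by (simp add: bernoulli_poly_gf)
qed

lemma S1_odd: "odd k \<Longrightarrow> S1 k = 0"
  by (simp add: S1_eq bernoulli_poly_half_odd)

text \<open>This is \<open>B\<^sub>n(3/2) - B\<^sub>n(1/2) = n (1/2)\<^bsup>n-1\<^esup>\<close> with the left-hand side expanded, for \<open>n + 1\<close> in place of
\<open>n\<close>. It expresses that \<open>s\<^sub>k = - (2/k) B\<^sub>k(1/2)\<close> solves the difference equation of the eigenvalues
coefficient by coefficient.\<close>

lemma bernoulli_poly_half_recurrence:
  "(\<Sum>k<Suc n. real (Suc n choose k) * bernoulli_poly k (1/2)) = real (Suc n) * (1/2)^n"
proof -
  have "fps_nth (bernoulli_gf (1/2) * (fps_exp 1 - 1)) (Suc n) = (1/2)^n / fact n"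
    unfolding bernoulli_gf_mult by simp
  hence "(\<Sum>i=0..Suc n. bernoulli_poly i (1/2) / fact i *
           (1 / fact (Suc n - i) - (if Suc n - i = 0 then 1 else 0))) = (1/2)^n / fact n"
    by (simp add: fps_mult_nth bernoulli_poly_gf del: sum.atLeast0_atMost_Suc sum.cl_ivl_Suc cong: if_cong)
  also have "(\<Sum>i=0..Suc n. bernoulli_poly i (1/2) / fact i *
           (1 / fact (Suc n - i) - (if Suc n - i = 0 then 1 else 0)))
        = (\<Sum>k<Suc n. bernoulli_poly k (1/2) / fact k * (1 / fact (Suc n - k)))"
    by (rule sum.mono_neutral_cong_right) auto
  also have "\<dots> = (\<Sum>k<Suc n. real (Suc n choose k) * bernoulli_poly k (1/2)) / fact (Suc n)"
    unfolding sum_divide_distrib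
    by (rule sum.cong) (auto simp: binomial_fact field_simps simp del: fact_Suc)
  finally have "(\<Sum>k<Suc n. real (Suc n choose k) * bernoulli_poly k (1/2)) = (1/2)^n / fact n * fact (Suc n)"
    by (metis fact_nonzero nonzero_eq_divide_eq)
  thus ?thesis by (simp only: fact_Suc of_nat_mult) (simp add: mult_ac)
qed

section \<open>Ordinary Bell polynomials and the expansion of exponentials\<close>

definition multi_exponents :: "'i set \<Rightarrow> nat \<Rightarrow> ('i \<Rightarrow> nat) set" where
  "multi_exponents A k = {j. (\<forall>i. i \<notin> A \<longrightarrow> j i = 0) \<and> (\<Sum>i\<in>A. j i) = k}"

lemma finite_multi_exponents:
  assumes "finite A" shows "finite (multi_exponents A k)"
proof (rule finite_subset)
  show "multi_exponents A k \<subseteq> {f. \<forall>i. (i \<in> A \<longrightarrow> f i \<in> {..k}) \<and> (i \<notin> A \<longrightarrow> f i = 0)}"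
    using assms by (auto simp: multi_exponents_def intro: member_le_sum)
  show "finite {f. \<forall>i. (i \<in> A \<longrightarrow> f i \<in> {..k}) \<and> (i \<notin> A \<longrightarrow> f i = 0)}"
    using assms by (intro finite_set_of_finite_funs) auto
qed

text \<open>Dividing the multinomial theorem by \<open>k!\<close> distributes the factorials over the factors. The
induction step is then the binomial theorem, split by the exponent of the new variable.\<close>

lemma multinomial_divided:
  fixes x :: "'i \<Rightarrow> 'a :: field_char_0"
  assumes "finite A"
  shows "(\<Sum>i\<in>A. x i) ^ k / fact k =
           (\<Sum>j\<in>multi_exponents A k. \<Prod>i\<in>A. x i ^ j i / fact (j i))"
  using assms
proof (induction A arbitrary: k)
  case empty
  have "multi_exponents {} k = (if k = 0 then {\<lambda>_. 0} else {} :: ('i \<Rightarrow> nat) set)"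
    by (auto simp: multi_exponents_def)
  thus ?case by auto
next
  case (insert a A)
  let ?w = "\<lambda>A j. \<Prod>i\<in>A. x i ^ j i / fact (j i)"
  have ne: "i \<noteq> a" if "i \<in> A" for i using that insert.hyps by auto
  have "(\<Sum>i\<in>insert a A. x i) ^ k / fact k
       = (\<Sum>l\<le>k. x a ^ l / fact l * ((\<Sum>i\<in>A. x i) ^ (k - l) / fact (k - l)))"
    using insert.hyps
    by (simp add: binomial_ring sum_divide_distrib binomial_fact field_simps)
  also have "\<dots> = (\<Sum>l\<le>k. \<Sum>j\<in>multi_exponents A (k - l). x a ^ l / fact l * ?w A j)"
    by (simp add: insert.IH sum_distrib_left)
  also have "\<dots> = (\<Sum>(l,j)\<in>(SIGMA l:{..k}. multi_exponents A (k - l)). x a ^ l / fact l * ?w A j)"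
    using insert.hyps by (subst sum.Sigma) (auto intro: finite_multi_exponents)
  also have "\<dots> = (\<Sum>j\<in>multi_exponents (insert a A) k. ?w (insert a A) j)"
  proof (rule sum.reindex_bij_witness[where i = "\<lambda>j. (j a, j(a := 0))" and j = "\<lambda>(l,j). j(a := l)"],
         goal_cases)
    case (1 p)
    thus ?case using insert.hyps by (cases p) (auto simp: multi_exponents_def)
  next
    case (2 p)
    thus ?case using insert.hyps ne
      by (cases p) (auto simp: multi_exponents_def cong: sum.cong)
  next
    case (3 j)
    thus ?case by auto
  next
    case (4 j)
    thus ?case using insert.hyps ne by (auto simp: multi_exponents_def cong: sum.cong)
  next
    case (5 p)
    thus ?case using insert.hyps ne by (cases p) (auto cong: prod.cong)
  qed
  finally show ?case .
qed

text \<open>The exponents of the Bell polynomial live on \<open>{1..m-k+1}\<close>, those of the multinomial theorem with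
\<open>J\<close> variables on \<open>{1..J}\<close>. The two sets agree because a tuple with \<open>k\<close> entries, counted with
multiplicity, that uses the index \<open>i\<close> has weight at least \<open>i + (k - 1)\<close>.\<close>

lemma multi_exponents_weight_eq_bell:
  assumes "m \<le> J" "k \<le> m"
  shows "{j \<in> multi_exponents {1..J} k. (\<Sum>i=1..J. i * j i) = m} = bell_exponents m k"
    (is "?L = ?R")
proof (cases "k = 0")
  case True
  show ?thesis
  proof (cases "m = 0")
    case m: True
    have "(\<forall>i. i \<notin> {1..J} \<longrightarrow> j i = 0) \<and> (\<Sum>i=1..J. j i) = 0 \<longleftrightarrow> j = (\<lambda>_. 0)" for j :: "nat \<Rightarrow> nat"
      by (auto simp: fun_eq_iff)
    hence "?L = {\<lambda>_. 0}" using m True by (auto simp: multi_exponents_def)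
    moreover have "?R = {\<lambda>_. 0}"
    proof -
      have "(\<forall>i. i \<noteq> 1 \<longrightarrow> j i = 0) \<and> j 1 = 0 \<longleftrightarrow> j = (\<lambda>_. 0)" for j :: "nat \<Rightarrow> nat"
        by (metis ext)
      thus ?thesis using m True by (simp add: bell_exponents_def cong: conj_cong)
    qed
    ultimately show ?thesis by simp
  next
    case False
    thus ?thesis using True by (auto simp: multi_exponents_def bell_exponents_def)
  qed
next
  case k: False
  have sub: "{1..m - k + 1} \<subseteq> {1..J}" using assms k by auto
  have restrict: "(\<Sum>i=1..J. f i * j i) = (\<Sum>i=1..m - k + 1. f i * j i)"
    if "\<forall>i. i \<notin> {1..m - k + 1} \<longrightarrow> j i = 0" for f j :: "nat \<Rightarrow> nat"
    using that sub by (intro sum.mono_neutral_right) auto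
  \<comment> \<open>One entry \<open>i\<close> and \<open>k - 1\<close> further entries, each at least 1, exceed the weight \<open>m\<close>.\<close>
  have supp: "j i = 0" if j: "j \<in> ?L" and i: "i \<notin> {1..m - k + 1}" for i j
  proof (rule ccontr)
    assume nz: "j i \<noteq> 0"
    with j have iJ: "i \<in> {1..J}" by (auto simp: multi_exponents_def)
    have "(\<Sum>l\<in>{1..J}. j l) = j i + (\<Sum>l\<in>{1..J}-{i}. j l)"
      using iJ by (intro sum.remove) auto
    moreover have "(\<Sum>l\<in>{1..J}. l * j l) = i * j i + (\<Sum>l\<in>{1..J}-{i}. l * j l)"
      using iJ by (intro sum.remove) auto
    moreover have "(\<Sum>l\<in>{1..J}-{i}. j l) \<le> (\<Sum>l\<in>{1..J}-{i}. l * j l)"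
      by (rule sum_mono) auto
    moreover have "i + j i \<le> i * j i + 1"
    proof -
      obtain a b where "i = Suc a" "j i = Suc b" using nz iJ by (cases i; cases "j i") auto
      thus ?thesis by simp
    qed
    ultimately have "i + k \<le> m + 1" using j by (simp add: multi_exponents_def)
    thus False using i iJ assms by auto
  qed
  show ?thesis
  proof (intro set_eqI iffI)
    fix j assume j: "j \<in> ?L"
    hence s: "\<forall>i. i \<notin> {1..m - k + 1} \<longrightarrow> j i = 0" using supp by blast
    have "(\<Sum>i=1..J. j i) = k" "(\<Sum>i=1..J. i * j i) = m"
      using j by (simp_all add: multi_exponents_def)
    hence "(\<Sum>i=1..m - k + 1. j i) = k" "(\<Sum>i=1..m - k + 1. i * j i) = m"
      using restrict[OF s, of "\<lambda>_. 1"] restrict[OF s, of "\<lambda>i. i"] by (simp_all only: mult_1)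
    thus "j \<in> ?R" using s unfolding bell_exponents_def by blast
  next
    fix j assume j: "j \<in> ?R"
    hence s: "\<forall>i. i \<notin> {1..m - k + 1} \<longrightarrow> j i = 0" by (auto simp: bell_exponents_def)
    have "(\<Sum>i=1..m - k + 1. j i) = k" "(\<Sum>i=1..m - k + 1. i * j i) = m"
      using j unfolding bell_exponents_def by blast+
    hence "(\<Sum>i=1..J. j i) = k" "(\<Sum>i=1..J. i * j i) = m"
      using restrict[OF s, of "\<lambda>_. 1"] restrict[OF s, of "\<lambda>i. i"] by (simp_all only: mult_1)
    moreover have "\<forall>i. i \<notin> {1..J} \<longrightarrow> j i = 0" using s sub by blast
    ultimately show "j \<in> ?L" unfolding multi_exponents_def by blast
  qed
qed

lemma multi_exponents_weight_ge:
  assumes "j \<in> multi_exponents {1..J} k"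
  shows "k \<le> (\<Sum>i=1..J. i * j i)"
proof -
  have "(\<Sum>i=1..J. j i) \<le> (\<Sum>i=1..J. i * j i)" by (rule sum_mono) auto
  thus ?thesis using assms by (simp add: multi_exponents_def)
qed

text \<open>In other words, the ordinary Bell polynomial is the coefficient of \<open>x\<^sup>m\<close> in
\<open>(s\<^sub>1 x + \<dots> + s\<^sub>J x\<^sup>J)\<^sup>k\<close>.\<close>

lemma ordinary_bell_eq_multi:
  fixes s :: "nat \<Rightarrow> 'a :: field_char_0"
  assumes "m \<le> J" "k \<le> m"
  shows "(\<Sum>j | j \<in> multi_exponents {1..J} k \<and> (\<Sum>i=1..J. i * j i) = m. \<Prod>i=1..J. s i ^ j i / fact (j i))
         = ordinary_bell m k s / fact k"
proof -
  have "(\<Prod>i=1..J. s i ^ j i / fact (j i)) =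
        1 / (\<Prod>i=1..m - k + 1. fact (j i)) * (\<Prod>i=1..m - k + 1. s i ^ j i)"
    if j: "j \<in> bell_exponents m k" for j
  proof -
    have j': "j \<in> multi_exponents {1..J} k"
      using j multi_exponents_weight_eq_bell[OF assms] by auto
    have "(\<Prod>i=1..J. s i ^ j i / fact (j i)) =
          (\<Prod>i\<in>{1..J} \<inter> {1..m-k+1}. s i ^ j i / fact (j i))"
      using j by (intro prod.mono_neutral_right) (auto simp: bell_exponents_def)
    also have "\<dots> = (\<Prod>i=1..m - k + 1. s i ^ j i / fact (j i))"
      using j' by (intro prod.mono_neutral_left) (auto simp: multi_exponents_def)
    finally show ?thesis by (simp add: prod_dividef)
  qed
  thus ?thesis
    unfolding multi_exponents_weight_eq_bell[OF assms] ordinary_bell_def sum_divide_distrib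
    by (intro sum.cong) (auto simp: field_simps)
qed

lemma p_poly_0: "p_poly 0 s t = 1"
proof -
  have "bell_exponents 0 0 = {\<lambda>_. 0}" by (auto simp: bell_exponents_def fun_eq_iff) metis
  thus ?thesis by (simp add: p_poly_def ordinary_bell_def)
qed

text \<open>If the weight \<open>\<Sum>i. i * j\<^sub>i\<close> of an exponent tuple is odd, then some odd index \<open>i\<close> occurs in it, and the
factor \<open>s\<^sub>i\<close> kills the monomial.\<close>

lemma p_poly_odd:
  assumes s: "\<And>k. odd k \<Longrightarrow> s k = 0" and n: "odd n"
  shows "p_poly n s t = 0"
proof -
  have "(\<Prod>i=1..n - k + 1. s i ^ j i) = 0" if j: "j \<in> bell_exponents n k" for k j
  proof -
    have "odd (\<Sum>i=1..n - k + 1. i * j i)" using j n by (simp add: bell_exponents_def)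
    then obtain i where "i \<in> {1..n-k+1}" "odd (i * j i)"
      using dvd_sum[of "{1..n-k+1}" 2 "\<lambda>i. i * j i"] by blast
    moreover have "s i ^ j i = 0" using calculation s by (auto intro!: odd_pos)
    ultimately show ?thesis by (intro prod_zero) auto
  qed
  hence "ordinary_bell n k s = (\<Sum>j\<in>bell_exponents n k. 0)" for k
    unfolding ordinary_bell_def by (intro sum.cong refl) (simp only: mult_zero_right)
  thus ?thesis by (simp add: p_poly_def)
qed

lemma p_poly_of_real:
  "p_poly n (\<lambda>k. of_real (s k)) (of_real t) = (of_real (p_poly n s t) :: complex)"
  by (simp add: p_poly_def ordinary_bell_def)

text \<open>The polynomials \<open>p\<^sub>j(t)\<close> are the Taylor coefficients of \<open>exp (- t Q(x))\<close> in \<open>x\<close>, where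
\<open>Q(x) = s\<^sub>1 x + \<dots> + s\<^sub>J x\<^sup>J\<close>. Since \<open>Q(x) = O(x)\<close>, truncating the exponential series after the power
\<open>J\<close> costs only \<open>O(x\<^bsup>J+1\<^esup>)\<close>. What remains is a polynomial in \<open>x\<close>; the multinomial theorem identifies
its coefficients up to \<open>x\<^sup>J\<close>, and the others are again \<open>O(x\<^bsup>J+1\<^esup>)\<close>. All estimates are uniform for
bounded \<open>t\<close>, which is what makes the sums of remainders holomorphic later on.\<close>

lemma exp_polynomial_expansion:
  fixes s :: "nat \<Rightarrow> complex"
  shows "\<exists>C\<ge>0. \<forall>t x. norm t \<le> R \<longrightarrow> 0 \<le> x \<longrightarrow> x \<le> 1 \<longrightarrow>
    norm (exp (- t * (\<Sum>k=1..J. s k * of_real x ^ k)) - (\<Sum>j\<le>J. p_poly j s t * of_real x ^ j))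
      \<le> C * x ^ (J + 1)"
proof -
  define w where "w j = (\<Sum>i=1..J. i * j i)" for j :: "nat \<Rightarrow> nat"
  define c where "c j = (\<Prod>i=1..J. s i ^ j i / fact (j i))" for j :: "nat \<Rightarrow> nat"
  define E where "E k = multi_exponents {1..J} k" for k
  have finE: "finite (E k)" for k unfolding E_def by (rule finite_multi_exponents) auto
  define S where "S = (\<Sum>k=1..J. norm (s k))"
  define R' where "R' = max R 0"
  define C1 where "C1 = (\<Sum>k\<le>J. R' ^ k * (\<Sum>j\<in>E k. norm (c j)))"
  define C2 where "C2 = (R' * S) ^ (J + 1) * exp (R' * S)"
  have S0: "S \<ge> 0" "R' \<ge> 0" "R \<le> R'" by (auto simp: S_def R'_def intro: sum_nonneg)
  have C0: "C1 \<ge> 0" "C2 \<ge> 0"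
    using S0 by (auto simp: C1_def C2_def intro!: sum_nonneg mult_nonneg_nonneg)
  have pow: "(\<Sum>k=1..J. s k * y ^ k) ^ k / fact k = (\<Sum>j\<in>E k. c j * y ^ w j)" for y k
  proof -
    have "(\<Prod>i=1..J. (s i * y ^ i) ^ j i / fact (j i)) = c j * y ^ w j" for j
      by (simp add: c_def w_def power_mult_distrib power_mult[symmetric] power_sum
          prod.distrib[symmetric] algebra_simps)
    thus ?thesis by (subst multinomial_divided) (auto simp: E_def)
  qed
  show ?thesis
  proof (intro exI[of _ "C1 + C2"] conjI allI impI)
    show "C1 + C2 \<ge> 0" using C0 by simp
    fix t :: complex and x :: real
    assume t: "norm t \<le> R" and x: "0 \<le> x" "x \<le> 1"
    define y :: complex where "y = of_real x"
    have ny: "norm y = x" using x by (simp add: y_def)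
    define Q where "Q = (\<Sum>k=1..J. s k * y ^ k)"
    have nQ: "norm Q \<le> S * x"
    proof -
      have "norm Q \<le> (\<Sum>k=1..J. norm (s k) * x)"
        unfolding Q_def
      proof (rule sum_norm_le)
        fix k assume "k \<in> {1..J}"
        hence "x ^ k \<le> x ^ 1" using x by (intro power_decreasing) auto
        thus "norm (s k * y ^ k) \<le> norm (s k) * x"
          by (simp add: norm_mult norm_power ny mult_left_mono)
      qed
      thus ?thesis by (simp add: S_def sum_distrib_right)
    qed
    have ntQ: "norm (- t * Q) \<le> R' * S * x"
    proof -
      have "norm t * norm Q \<le> R' * (S * x)"
        using nQ t S0 x by (intro mult_mono) auto
      thus ?thesis by (simp add: norm_mult)
    qed
    have ntQ': "norm (- t * Q) \<le> R' * S"
      using ntQ x S0 by (smt (verit) mult_left_le mult_nonneg_nonneg)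
    have "norm (exp (- t * Q) - (\<Sum>k\<le>J. (- t * Q) ^ k / fact k)) \<le> exp (norm (- t * Q)) * norm (- t * Q) ^ Suc J"
    proof -
      have "norm (exp (- t * Q) - (\<Sum>k\<le>J. (- t * Q) ^ k / fact k))
           \<le> exp \<bar>Re (- t * Q)\<bar> * norm (- t * Q) ^ Suc J / fact J"
        by (rule Taylor_exp)
      also have "\<dots> \<le> exp (norm (- t * Q)) * norm (- t * Q) ^ Suc J / 1"
        using abs_Re_le_cmod[of "- t * Q"] by (intro frac_le mult_right_mono) auto
      finally show ?thesis by simp
    qed
    also have "\<dots> \<le> exp (R' * S) * (R' * S * x) ^ Suc J"
      using ntQ ntQ' by (intro mult_mono power_mono) auto
    also have "\<dots> = C2 * x ^ (J + 1)" by (simp add: C2_def power_mult_distrib)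
    finally have 1: "norm (exp (- t * Q) - (\<Sum>k\<le>J. (- t * Q) ^ k / fact k)) \<le> C2 * x ^ (J + 1)" .
    \<comment> \<open>The monomials are sorted by their weight, which is the power of \<open>x\<close>.\<close>
    have split: "(\<Sum>k\<le>J. (- t * Q) ^ k / fact k) =
        (\<Sum>k\<le>J. (- t) ^ k * (\<Sum>j | j \<in> E k \<and> w j \<le> J. c j * y ^ w j))
      + (\<Sum>k\<le>J. (- t) ^ k * (\<Sum>j | j \<in> E k \<and> \<not> w j \<le> J. c j * y ^ w j))"
    proof -
      have "(- t * Q) ^ k / fact k = (- t) ^ k * (\<Sum>j | j \<in> E k \<and> w j \<le> J. c j * y ^ w j)
            + (- t) ^ k * (\<Sum>j | j \<in> E k \<and> \<not> w j \<le> J. c j * y ^ w j)" for k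
      proof -
        have "(- t * Q) ^ k / fact k = (- t) ^ k * (Q ^ k / fact k)" by (simp only: power_mult_distrib times_divide_eq_right)
        also have "Q ^ k / fact k = (\<Sum>j\<in>E k. c j * y ^ w j)" unfolding Q_def by (rule pow)
        also have "\<dots> = (\<Sum>j | j \<in> E k \<and> w j \<le> J. c j * y ^ w j) + (\<Sum>j | j \<in> E k \<and> \<not> w j \<le> J. c j * y ^ w j)"
          using finE by (subst sum.union_disjoint[symmetric]) (auto intro!: sum.cong)
        finally show ?thesis by (simp add: algebra_simps)
      qed
      thus ?thesis by (simp add: sum.distrib)
    qed
    have main: "(\<Sum>k\<le>J. (- t) ^ k * (\<Sum>j | j \<in> E k \<and> w j \<le> J. c j * y ^ w j)) = (\<Sum>m\<le>J. p_poly m s t * y ^ m)"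
    proof -
      have "(\<Sum>j | j \<in> E k \<and> w j \<le> J. c j * y ^ w j) =
            (\<Sum>m\<le>J. if k \<le> m then ordinary_bell m k s / fact k * y ^ m else 0)" for k
      proof -
        have "(\<Sum>j | j \<in> E k \<and> w j \<le> J. c j * y ^ w j) =
              (\<Sum>m\<le>J. \<Sum>j | j \<in> {j. j \<in> E k \<and> w j \<le> J} \<and> w j = m. c j * y ^ w j)"
          using finE by (intro sum.group[symmetric]) auto
        also have "\<dots> = (\<Sum>m\<le>J. if k \<le> m then ordinary_bell m k s / fact k * y ^ m else 0)"
        proof (rule sum.cong[OF refl])
          fix m assume m: "m \<in> {..J}"
          have eq: "{j. j \<in> {j. j \<in> E k \<and> w j \<le> J} \<and> w j = m} = {j. j \<in> E k \<and> w j = m}"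
            using m by auto
          have "(\<Sum>j | j \<in> E k \<and> w j = m. c j * y ^ w j) = (\<Sum>j | j \<in> E k \<and> w j = m. c j) * y ^ m"
            by (simp add: sum_distrib_right)
          also have "\<dots> = (if k \<le> m then ordinary_bell m k s / fact k * y ^ m else 0)"
          proof (cases "k \<le> m")
            case True
            thus ?thesis using ordinary_bell_eq_multi[of m J k s] m
              unfolding E_def c_def w_def by simp
          next
            case False
            hence "{j. j \<in> E k \<and> w j = m} = {}"
              using multi_exponents_weight_ge unfolding E_def w_def by blast
            thus ?thesis using False by (simp only: sum.empty) simp
          qed
          finally show "(\<Sum>j | j \<in> {j. j \<in> E k \<and> w j \<le> J} \<and> w j = m. c j * y ^ w j) =
            (if k \<le> m then ordinary_bell m k s / fact k * y ^ m else 0)" unfolding eq .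
        qed
        finally show ?thesis .
      qed
      hence "(\<Sum>k\<le>J. (- t) ^ k * (\<Sum>j | j \<in> E k \<and> w j \<le> J. c j * y ^ w j)) =
         (\<Sum>k\<le>J. \<Sum>m\<le>J. if k \<le> m then (- t) ^ k * (ordinary_bell m k s / fact k * y ^ m) else 0)"
        by (simp add: sum_distrib_left if_distrib cong: if_cong)
      also have "\<dots> = (\<Sum>m\<le>J. \<Sum>k\<le>J. if k \<le> m then (- t) ^ k * (ordinary_bell m k s / fact k * y ^ m) else 0)"
        by (rule sum.swap)
      also have "\<dots> = (\<Sum>m\<le>J. p_poly m s t * y ^ m)"
      proof (rule sum.cong[OF refl])
        fix m assume m: "m \<in> {..J}"
        have "(\<Sum>k\<le>J. if k \<le> m then (- t) ^ k * (ordinary_bell m k s / fact k * y ^ m) else 0)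
            = (\<Sum>k\<le>m. (- t) ^ k * (ordinary_bell m k s / fact k * y ^ m))"
          using m by (intro sum.mono_neutral_cong_right) auto
        also have "\<dots> = p_poly m s t * y ^ m"
          unfolding p_poly_def sum_distrib_right
          by (rule sum.cong[OF refl]) (subst power_minus, simp)
        finally show "(\<Sum>k\<le>J. if k \<le> m then (- t) ^ k * (ordinary_bell m k s / fact k * y ^ m) else 0)
            = p_poly m s t * y ^ m" .
      qed
      finally show ?thesis .
    qed
    have 2: "norm (\<Sum>k\<le>J. (- t) ^ k * (\<Sum>j | j \<in> E k \<and> \<not> w j \<le> J. c j * y ^ w j)) \<le> C1 * x ^ (J + 1)"
      unfolding C1_def sum_distrib_right
    proof (rule sum_norm_le)
      fix k assume "k \<in> {..J}"
      have "norm (\<Sum>j | j \<in> E k \<and> \<not> w j \<le> J. c j * y ^ w j) \<le> (\<Sum>j | j \<in> E k \<and> \<not> w j \<le> J. norm (c j) * x ^ (J + 1))"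
        using x by (intro sum_norm_le) (auto simp: norm_mult norm_power ny intro!: mult_left_mono power_decreasing simp del: power_Suc)
      also have "\<dots> \<le> (\<Sum>j\<in>E k. norm (c j) * x ^ (J + 1))"
        using finE x by (intro sum_mono2) auto
      finally have "norm (\<Sum>j | j \<in> E k \<and> \<not> w j \<le> J. c j * y ^ w j) \<le> (\<Sum>j\<in>E k. norm (c j)) * x ^ (J + 1)"
        by (simp add: sum_distrib_right)
      moreover have "norm ((- t) ^ k) \<le> R' ^ k"
        using t S0 by (simp add: norm_power power_mono)
      ultimately have "norm ((- t) ^ k) * norm (\<Sum>j | j \<in> E k \<and> \<not> w j \<le> J. c j * y ^ w j)
            \<le> R' ^ k * ((\<Sum>j\<in>E k. norm (c j)) * x ^ (J + 1))"
        using S0 by (intro mult_mono) auto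
      thus "norm ((- t) ^ k * (\<Sum>j | j \<in> E k \<and> \<not> w j \<le> J. c j * y ^ w j))
            \<le> R' ^ k * (\<Sum>j\<in>E k. norm (c j)) * x ^ (J + 1)"
        by (simp add: norm_mult mult.assoc)
    qed
    have "norm (exp (- t * Q) - (\<Sum>m\<le>J. p_poly m s t * y ^ m)) \<le> C2 * x ^ (J+1) + C1 * x ^ (J+1)"
      using norm_triangle_ineq[of "exp (- t * Q) - (\<Sum>k\<le>J. (- t * Q) ^ k / fact k)"
         "\<Sum>k\<le>J. (- t) ^ k * (\<Sum>j | j \<in> E k \<and> \<not> w j \<le> J. c j * y ^ w j)"] 1 2
      unfolding split main by simp
    thus "norm (exp (- t * (\<Sum>k=1..J. s k * of_real x ^ k)) - (\<Sum>j\<le>J. p_poly j s t * of_real x ^ j))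
      \<le> (C1 + C2) * x ^ (J + 1)"
      by (simp add: Q_def y_def algebra_simps)
  qed
qed

lemma norm_exp_minus_one_le: "norm (exp z - 1 :: complex) \<le> norm z * exp (norm z)"
proof -
  have "norm (exp z - (\<Sum>k\<le>0. z ^ k / fact k)) \<le> exp \<bar>Re z\<bar> * norm z ^ Suc 0 / fact 0"
    by (rule Taylor_exp)
  also have "\<dots> \<le> exp (norm z) * norm z"
    using abs_Re_le_cmod[of z] by (auto intro!: mult_right_mono)
  finally show ?thesis by (simp add: mult.commute)
qed

text \<open>Perturbing the exponent by \<open>O(n\<^bsup>-J-1\<^esup>)\<close> changes the exponential by the same order, so the expansion
of the polynomial case carries over to every sequence that has an asymptotic expansion in \<open>1/n\<close>.\<close>

lemma exp_asymptotic_expansion: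
  fixes s w :: "nat \<Rightarrow> complex"
  assumes w: "\<And>n. n \<ge> 1 \<Longrightarrow> norm (w n - (\<Sum>k=1..J. s k * of_real (1 / real n) ^ k)) \<le> D * (1 / real n) ^ (J + 1)"
  shows "\<exists>C\<ge>0. \<forall>n\<ge>1. \<forall>t::complex. norm t \<le> R \<longrightarrow>
     norm (exp (- t * w n) - (\<Sum>j\<le>J. p_poly j s t * of_real (1 / real n) ^ j)) \<le> C * (1 / real n) ^ (J + 1)"
proof -
  obtain C1 where C1: "C1 \<ge> 0" "\<And>(t::complex) x. norm t \<le> R \<Longrightarrow> 0 \<le> x \<Longrightarrow> x \<le> 1 \<Longrightarrow>
    norm (exp (- t * (\<Sum>k=1..J. s k * of_real x ^ k)) - (\<Sum>j\<le>J. p_poly j s t * of_real x ^ j))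
      \<le> C1 * x ^ (J + 1)"
    using exp_polynomial_expansion[where R = R and J = J and s = s] by blast
  define S where "S = (\<Sum>k=1..J. norm (s k))"
  define R' where "R' = max R 0"
  define C2 where "C2 = exp (R' * S) * (R' * \<bar>D\<bar> * exp (R' * \<bar>D\<bar>))"
  have S0: "S \<ge> 0" "R' \<ge> 0" "R \<le> R'" by (auto simp: S_def R'_def intro: sum_nonneg)
  show ?thesis
  proof (intro exI[of _ "C1 + C2"] conjI allI impI)
    show "0 \<le> C1 + C2" using C1 S0 by (auto simp: C2_def)
    fix n :: nat and t :: complex assume n: "n \<ge> 1" and t: "norm t \<le> R"
    define x where "x = 1 / real n"
    have x: "0 \<le> x" "x \<le> 1" using n by (auto simp: x_def)
    define Q where "Q = (\<Sum>k=1..J. s k * of_real x ^ k)"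
    define p where "p = (\<Sum>j\<le>J. p_poly j s t * of_real x ^ j)"
    have nQ: "norm Q \<le> S"
      unfolding Q_def S_def using x
      by (intro sum_norm_le) (auto simp: norm_mult norm_power power_le_one mult_left_le)
    have nd: "norm (w n - Q) \<le> \<bar>D\<bar> * x ^ (J + 1)"
      using w[OF n] x unfolding Q_def x_def[symmetric]
      by (smt (verit) mult_right_mono zero_le_power)
    have x1: "x ^ (J + 1) \<le> 1" "x ^ (J + 1) \<ge> 0" using x by (auto intro: power_le_one simp del: power_Suc)
    have nd2: "norm (- t * (w n - Q)) \<le> R' * \<bar>D\<bar> * x ^ (J + 1)"
    proof -
      have "norm t * norm (w n - Q) \<le> R' * (\<bar>D\<bar> * x ^ (J + 1))"
        using nd t S0 by (intro mult_mono) auto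
      thus ?thesis by (simp add: norm_mult mult.assoc)
    qed
    have "R' * \<bar>D\<bar> * x ^ (J + 1) \<le> R' * \<bar>D\<bar>" using x1 S0 by (intro mult_left_le) auto
    hence nd1: "norm (- t * (w n - Q)) \<le> R' * \<bar>D\<bar>" using nd2 by linarith
    have ntQ: "norm (- t * Q) \<le> R' * S"
      using nQ t S0 by (auto simp: norm_mult intro!: mult_mono)
    have "exp (- t * w n) - exp (- t * Q) = exp (- t * Q) * (exp (- t * (w n - Q)) - 1)"
      by (simp add: algebra_simps flip: exp_add)
    hence "norm (exp (- t * w n) - exp (- t * Q)) =
        norm (exp (- t * Q)) * norm (exp (- t * (w n - Q)) - 1)" by (simp add: norm_mult)
    also have "\<dots> \<le> exp (norm (- t * Q)) * (norm (- t * (w n - Q)) * exp (norm (- t * (w n - Q))))"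
      by (intro mult_mono norm_exp norm_exp_minus_one_le) auto
    also have "\<dots> \<le> exp (R' * S) * ((R' * \<bar>D\<bar> * x ^ (J + 1)) * exp (R' * \<bar>D\<bar>))"
      using ntQ nd1 nd2 S0 x1 by (intro mult_mono) (auto simp del: power_Suc norm_mult)
    also have "\<dots> = C2 * x ^ (J + 1)" by (simp add: C2_def)
    finally have "norm (exp (- t * w n) - exp (- t * Q)) \<le> C2 * x ^ (J + 1)" .
    moreover have "norm (exp (- t * Q) - p) \<le> C1 * x ^ (J + 1)"
      using C1(2)[OF t x] by (simp add: Q_def p_def)
    ultimately have "norm (exp (- t * w n) - p) \<le> C2 * x ^ (J + 1) + C1 * x ^ (J + 1)"
      using norm_triangle_ineq[of "exp (- t * w n) - exp (- t * Q)" "exp (- t * Q) - p"] by simp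
    hence "norm (exp (- t * w n) - p) \<le> (C1 + C2) * x ^ (J + 1)"
      by (simp only: distrib_right add.commute)
    thus "norm (exp (- t * w n) - (\<Sum>j\<le>J. p_poly j s t * of_real (1 / real n) ^ j)) \<le> (C1 + C2) * (1 / real n) ^ (J + 1)"
      by (simp only: p_def x_def)
  qed
qed

section \<open>The asymptotic expansion of the eigenvalues\<close>

lemma has_fps_expansion_imp_power_bound:
  fixes f :: "real \<Rightarrow> real"
  assumes f: "f has_fps_expansion F" and F: "\<And>i. i < m \<Longrightarrow> fps_nth F i = 0"
  shows "\<exists>C\<ge>0. \<exists>d>0. \<forall>x. \<bar>x\<bar> < d \<longrightarrow> \<bar>f x\<bar> \<le> C * \<bar>x\<bar> ^ m"
proof (cases "F = 0")
  case True
  with f have "eventually (\<lambda>x. f x = 0) (nhds 0)"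
    by (auto simp: has_fps_expansion_def elim: eventually_mono)
  then obtain d where "d > 0" "\<And>x. \<bar>x\<bar> < d \<Longrightarrow> f x = 0"
    by (auto simp: eventually_nhds_metric dist_real_def)
  thus ?thesis by (intro exI[of _ 0]) auto
next
  case False
  hence m: "m \<le> subdegree F" using F by (intro subdegree_geI) auto
  define g where "g = (\<lambda>x. if x = 0 then fps_nth F m else f x / x ^ m)"
  have "g has_fps_expansion fps_shift m F"
    unfolding g_def by (rule has_fps_expansion_shift[OF f m refl])
  hence "continuous (at 0) g" by (rule has_fps_expansion_imp_continuous)
  hence "eventually (\<lambda>x. dist (g x) (g 0) < 1) (at 0)"
    unfolding continuous_at by (rule tendstoD) simp
  then obtain d where d: "d > 0" "\<And>x. x \<noteq> 0 \<Longrightarrow> \<bar>x\<bar> < d \<Longrightarrow> \<bar>g x - g 0\<bar> < 1"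
    by (auto simp: eventually_at dist_real_def)
  have f0: "f 0 = fps_nth F 0" using f has_fps_expansion_imp_0_eq_fps_nth_0 by metis
  have "\<bar>f x\<bar> \<le> (\<bar>g 0\<bar> + 1) * \<bar>x\<bar> ^ m" if "\<bar>x\<bar> < d" for x
  proof (cases "x = 0")
    case True
    thus ?thesis using f0 F[of 0] by (cases "m = 0") (auto simp: g_def)
  next
    case False
    hence "f x = g x * x ^ m" by (simp add: g_def)
    moreover have "\<bar>g x\<bar> \<le> \<bar>g 0\<bar> + 1" using d(2)[OF False that] by linarith
    ultimately show ?thesis by (simp add: abs_mult power_abs mult_right_mono)
  qed
  thus ?thesis using d(1) by (intro exI[of _ "\<bar>g 0\<bar> + 1"]) auto
qed

text \<open>By how much the truncated expansion \<open>2 ln n + \<Sum>k\<le>J. s\<^sub>k n\<^bsup>-k\<^esup>\<close> fails to satisfy the difference equation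
\<open>2 \<lambda>\<^sub>n\<^sub>+\<^sub>1 - 2 \<lambda>\<^sub>n = 4 / (2 n + 1)\<close>, as a function of \<open>x = 1/n\<close>; note that \<open>1/(n+1) = x / (1 + x)\<close>.\<close>

definition lam_defect :: "nat \<Rightarrow> real \<Rightarrow> real" where
  "lam_defect J x = 4 * x / (2 + x) - 2 * ln (1 + x) - (\<Sum>k=1..J. S1 k * ((x / (1 + x)) ^ k - x ^ k))"

lemma has_fps_expansion_ln_1_plus:
  "(\<lambda>x::real. ln (1 + x)) has_fps_expansion Abs_fps (\<lambda>n. - ((-1) ^ n) / real n)"
proof (rule has_fps_expansionI)
  have "eventually (\<lambda>u. u \<in> ball 0 1) (nhds (0::real))" by (rule eventually_nhds_in_open) auto
  thus "eventually (\<lambda>u. (\<lambda>n. fps_nth (Abs_fps (\<lambda>n. - ((-1) ^ n) / real n)) n * u ^ n) sums ln (1 + u)) (nhds 0)"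
  proof eventually_elim
    case (elim u)
    hence "cmod (of_real u) < 1" by simp
    hence "(\<lambda>n. - ((- complex_of_real u) ^ n) / of_nat n) sums ln (1 + complex_of_real u)"
      by (rule Ln_series')
    also have "ln (1 + complex_of_real u) = of_real (ln (1 + u))"
      using elim by (subst Ln_of_real[symmetric]) auto
    also have "(\<lambda>n. - ((- complex_of_real u) ^ n) / of_nat n) = (\<lambda>n. of_real (- ((-u) ^ n) / real n))"
      by simp
    finally have "(\<lambda>n. - ((-u) ^ n) / real n) sums ln (1 + u)" by (subst (asm) sums_of_real_iff)
    thus ?case by (simp add: power_minus[of u] mult_ac)
  qed
qed

lemma has_fps_expansion_lam_step:
  "(\<lambda>x::real. 4 * x / (2 + x)) has_fps_expansion Abs_fps (\<lambda>n. if n = 0 then 0 else 2 * (-1/2) ^ (n - 1))"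
proof (rule has_fps_expansionI)
  have "eventually (\<lambda>u. u \<in> ball 0 1) (nhds (0::real))" by (rule eventually_nhds_in_open) auto
  thus "eventually (\<lambda>u. (\<lambda>n. fps_nth (Abs_fps (\<lambda>n. if n = 0 then 0 else 2 * (-1/2) ^ (n - 1))) n * u ^ n)
          sums (4 * u / (2 + u :: real))) (nhds 0)"
  proof eventually_elim
    case (elim u)
    hence u: "\<bar>u\<bar> < 1" by simp
    have "(\<lambda>n. (-u/2) ^ n) sums (1 / (1 - (-u/2)))" using u by (intro geometric_sums) auto
    hence "(\<lambda>n. 2 * u * (-u/2) ^ n) sums (2 * u * (1 / (1 - (-u/2))))" by (rule sums_mult)
    also have "2 * u * (1 / (1 - (-u/2))) = 4 * u / (2 + u)" using u by (simp add: field_simps)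
    also have "(\<lambda>n. 2 * u * (-u/2) ^ n) =
       (\<lambda>n. fps_nth (Abs_fps (\<lambda>n. if n = 0 then 0 else 2 * (-1/2) ^ (n - 1))) (Suc n) * u ^ Suc n)"
      by (auto simp: fun_eq_iff power_mult_distrib[symmetric])
    finally have "(\<lambda>n. fps_nth (Abs_fps (\<lambda>n. if n = 0 then 0 else 2 * (-1/2) ^ (n - 1))) (Suc n) * u ^ Suc n)
       sums (4 * u / (2 + u))" .
    thus ?case by (subst (asm) sums_Suc_iff) simp
  qed
qed

lemma has_fps_expansion_shifted_power:
  "(\<lambda>x::real. (x / (1 + x)) ^ k) has_fps_expansion (fps_X ^ k * fps_binomial (- real k))"
proof -
  have "(\<lambda>x::real. (1 + x) powr (- real k)) has_fps_expansion fps_binomial (- real k)"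
  proof (rule has_fps_expansionI)
    have "eventually (\<lambda>u. u \<in> ball 0 1) (nhds (0::real))" by (rule eventually_nhds_in_open) auto
    thus "eventually (\<lambda>u. (\<lambda>n. fps_nth (fps_binomial (- real k)) n * u ^ n) sums (1 + u) powr (- real k)) (nhds 0)"
      by eventually_elim (auto intro: gen_binomial_real)
  qed
  hence *: "(\<lambda>x::real. x ^ k * (1 + x) powr (- real k)) has_fps_expansion (fps_X ^ k * fps_binomial (- real k))"
    by (intro has_fps_expansion_mult has_fps_expansion_fps_X_power)
  have "eventually (\<lambda>x. x \<in> ball 0 1) (nhds (0::real))" by (rule eventually_nhds_in_open) auto
  hence ev: "eventually (\<lambda>x::real. x ^ k * (1 + x) powr (- real k) = (x / (1 + x)) ^ k) (nhds 0)"
    by eventually_elim (auto simp: powr_minus powr_realpow power_divide field_simps)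
  show ?thesis by (rule iffD1[OF has_fps_expansion_cong[OF ev refl] *])
qed

text \<open>The left-hand side is the coefficient of \<open>x\<^sup>n\<close> in \<open>\<Sum>k. s\<^sub>k ((x / (1 + x))\<^sup>k - x\<^sup>k)\<close>. Absorbing \<open>1/k\<close> into the
binomial coefficient turns it into the recurrence for \<open>B\<^sub>k(1/2)\<close>; the signs \<open>(-1)\<^sup>k\<close> are harmless
because \<open>B\<^sub>k(1/2)\<close> vanishes for odd \<open>k\<close>.\<close>

lemma S1_binomial_sum:
  assumes "n \<ge> 1"
  shows "(\<Sum>k=1..<n. S1 k * ((-1) ^ (n - k) * real ((n - 1) choose (k - 1))))
         = - (2 / real n) * (-1) ^ n * (real n * (1/2) ^ (n - 1) - 1)"
proof -
  let ?b = "\<lambda>k. bernoulli_poly k (1/2)"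
  have b0: "?b 0 = 1" using bernoulli_poly_half_recurrence[of 0] by simp
  have "S1 k * ((-1) ^ (n - k) * real ((n - 1) choose (k - 1)))
        = - (2 / real n) * (-1) ^ n * (real (n choose k) * ?b k)" if k: "k \<in> {1..<n}" for k
  proof (cases "odd k")
    case True
    thus ?thesis by (simp add: S1_odd bernoulli_poly_half_odd)
  next
    case False
    have "(-1::real) ^ (n - k) = (-1) ^ n"
      using False k by (simp add: minus_one_power_iff)
    moreover have "real ((n - 1) choose (k - 1)) = real (n choose k) * real k / real n"
    proof -
      have "k * (n choose k) = n * ((n - 1) choose (k - 1))"
        using k by (intro times_binomial_minus1_eq) auto
      hence "real k * real (n choose k) = real n * real ((n - 1) choose (k - 1))"
        by (metis of_nat_mult)
      thus ?thesis using assms by (simp add: field_simps)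
    qed
    ultimately show ?thesis using k by (simp add: S1_eq field_simps)
  qed
  hence "(\<Sum>k=1..<n. S1 k * ((-1) ^ (n - k) * real ((n - 1) choose (k - 1))))
       = - (2 / real n) * (-1) ^ n * (\<Sum>k=1..<n. real (n choose k) * ?b k)"
    by (simp add: sum_distrib_left)
  also have "(\<Sum>k=1..<n. real (n choose k) * ?b k) = (\<Sum>k<n. real (n choose k) * ?b k) - 1"
    using assms by (simp add: lessThan_atLeast0 sum.atLeast_Suc_lessThan b0)
  also have "(\<Sum>k<n. real (n choose k) * ?b k) = real n * (1/2) ^ (n - 1)"
    using bernoulli_poly_half_recurrence[of "n - 1"] assms by simp
  finally show ?thesis .
qed

text \<open>The Taylor coefficients of the defect vanish up to \<open>x\<^bsup>J+1\<^esup>\<close>: this is the point where the Bernoulli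
numbers are forced to be the coefficients of the expansion. The coefficient of \<open>x\<^bsup>J+1\<^esup>\<close> still involves
only \<open>s\<^sub>1, \<dots>, s\<^sub>J\<close>, since \<open>(x / (1 + x))\<^sup>k - x\<^sup>k\<close> starts with \<open>x\<^bsup>k+1\<^esup>\<close>.\<close>

lemma lam_defect_bound:
  "\<exists>C\<ge>0. \<exists>d>0. \<forall>x. \<bar>x\<bar> < d \<longrightarrow> \<bar>lam_defect J x\<bar> \<le> C * \<bar>x\<bar> ^ (J + 2)"
proof (rule has_fps_expansion_imp_power_bound)
  let ?F = "Abs_fps (\<lambda>n. if n = 0 then 0 else 2 * (-1/2) ^ (n - 1))
      - fps_const 2 * Abs_fps (\<lambda>n. - ((-1) ^ n) / real n)
      - (\<Sum>k=1..J. fps_const (S1 k) * (fps_X ^ k * fps_binomial (- real k) - fps_X ^ k))"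
  show "lam_defect J has_fps_expansion ?F"
    unfolding lam_defect_def[abs_def]
    by (intro has_fps_expansion_diff has_fps_expansion_lam_step has_fps_expansion_cmult_left
        has_fps_expansion_ln_1_plus has_fps_expansion_sum has_fps_expansion_shifted_power
        has_fps_expansion_fps_X_power)
  fix n assume n: "n < J + 2"
  show "fps_nth ?F n = 0"
  proof (cases "n = 0")
    case True
    thus ?thesis by (auto simp: fps_sum_nth fps_X_power_mult_nth intro!: sum.neutral)
  next
    case False
    have "fps_nth (\<Sum>k=1..J. fps_const (S1 k) * (fps_X ^ k * fps_binomial (- real k) - fps_X ^ k)) n
      = (\<Sum>k=1..J. S1 k * ((if n < k then 0 else (- real k) gchoose (n - k)) - (if n = k then 1 else 0)))"
      by (simp add: fps_sum_nth fps_X_power_mult_nth fps_X_power_nth cong: if_cong)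
    also have "\<dots> = (\<Sum>k=1..<n. S1 k * ((-1) ^ (n - k) * real ((n - 1) choose (k - 1))))"
    proof (rule sum.mono_neutral_cong)
      fix k assume k: "k \<in> {1..J} \<inter> {1..<n}"
      have "(- real k) gchoose (n - k) = (-1) ^ (n - k) * ((real k + real (n - k) - 1) gchoose (n - k))"
        by (rule gbinomial_minus)
      also have "real k + real (n - k) - 1 = real (n - 1)" using k by auto
      also have "real (n - 1) gchoose (n - k) = real ((n - 1) choose (n - k))"
        by (rule binomial_gbinomial[symmetric])
      also have "(n - 1) choose (n - k) = (n - 1) choose (k - 1)"
        using k by (subst binomial_symmetric) auto
      finally show "S1 k * ((if n < k then 0 else (- real k) gchoose (n - k)) - (if n = k then 1 else 0))
         = S1 k * ((-1) ^ (n - k) * real ((n - 1) choose (k - 1)))" using k by auto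
    qed (use n in auto)
    also have "\<dots> = - (2 / real n) * (-1) ^ n * (real n * (1/2) ^ (n - 1) - 1)"
      using False by (intro S1_binomial_sum) auto
    finally have "fps_nth ?F n = 2 * (-1/2) ^ (n - 1) + 2 * (-1) ^ n / real n
        + (2 / real n) * (-1) ^ n * (real n * (1/2) ^ (n - 1) - 1)" using False by simp
    also have "\<dots> = 2 * (-1/2) ^ (n - 1) + 2 * (-1) ^ n * (1/2) ^ (n - 1)"
      using False by (simp add: field_simps)
    also have "\<dots> = 0"
    proof -
      obtain m where "n = Suc m" using False by (cases n) auto
      thus ?thesis by (simp add: power_mult_distrib[symmetric] flip: power_minus)
    qed
    finally show ?thesis .
  qed
qed

lemma lam_harm: "lam n = 2 * harm (2 * n) - harm n"
proof (induction n)
  case 0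
  show ?case by (simp add: lam_def harm_def)
next
  case (Suc n)
  have "harm (2 * Suc n) = harm (2 * n) + 1 / (2 * real n + 1) + 1 / (2 * (real n + 1))"
    by (simp add: harm_Suc inverse_eq_divide add_ac)
  moreover have "harm (Suc n) = harm n + 1 / (real n + 1)"
    by (simp add: harm_Suc inverse_eq_divide add_ac)
  moreover have "lam (Suc n) = lam n + 2 / (2 * real n + 1)" by (simp add: lam_def)
  moreover have "2 * (1 / (2 * (real n + 1))) = 1 / (real n + 1)" by (simp add: field_simps)
  ultimately show ?case using Suc.IH by (simp add: algebra_simps)
qed

text \<open>The difference equation determines the \<open>\<lambda>\<^sub>n\<close> only up to an additive constant, which is read off here
from the harmonic numbers.\<close>

lemma lam_minus_ln_tendsto: "(\<lambda>n. lam n - ln (real n)) \<longlonglongrightarrow> euler_mascheroni + 2 * ln 2"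
proof -
  let ?em = "\<lambda>n. harm n - ln (real n)"
  have "(\<lambda>n. 2 * ?em (2 * n) - ?em n + 2 * ln 2) \<longlonglongrightarrow> 2 * euler_mascheroni - euler_mascheroni + 2 * ln 2"
    by (intro tendsto_intros euler_mascheroni_LIMSEQ filterlim_compose[OF euler_mascheroni_LIMSEQ]
              filterlim_subseq) (auto simp: strict_mono_def)
  moreover have "eventually (\<lambda>n. 2 * ?em (2 * n) - ?em n + 2 * ln 2 = lam n - ln (real n)) sequentially"
    using eventually_gt_at_top[of 0] by eventually_elim (simp add: lam_harm ln_mult)
  ultimately show ?thesis by (auto intro: Lim_transform_eventually)
qed

text \<open>The sequence \<open>e n - 2 C / n\<^bsup>p+1\<^esup>\<close> is increasing from \<open>N\<close> on and tends to \<open>0\<close>, hence is nonpositive. The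
factor 2 comes from \<open>1 / n\<^bsup>p+1\<^esup> - 1 / (n+1)\<^bsup>p+1\<^esup> \<ge> 1 / (n\<^bsup>p+1\<^esup> (n+1)) \<ge> 1 / (2 n\<^bsup>p+2\<^esup>)\<close>.\<close>

lemma null_sequence_bound_of_differences:
  fixes e :: "nat \<Rightarrow> real"
  assumes lim: "e \<longlonglongrightarrow> 0" and C: "C \<ge> 0"
    and diff: "\<And>n. n \<ge> N \<Longrightarrow> \<bar>e (Suc n) - e n\<bar> \<le> C * (1 / real n) ^ (p + 2)"
    and n: "n \<ge> N" "n \<ge> 1"
  shows "e n \<le> 2 * C * (1 / real n) ^ (p + 1)"
proof -
  define h where "h m = e m - 2 * C * (1 / real m) ^ (p + 1)" for m
  have "h m \<le> h (Suc m)" if m: "m \<ge> n" for m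
  proof -
    have m1: "m \<ge> 1" using m n by simp
    have "(1 / real (Suc m)) ^ (p + 1) \<le> (1 / real m) ^ p * (1 / real (Suc m))"
      using m1 by (auto intro!: mult_mono power_mono frac_le simp: mult.commute)
    moreover have "(1 / real m) ^ (p + 1) - (1 / real m) ^ p * (1 / real (Suc m))
        = (1 / real m) ^ p * (1 / (real m * real (Suc m)))"
    proof -
      have "1 / real m - 1 / real (Suc m) = 1 / (real m * real (Suc m))"
        using m1 by (simp add: field_simps)
      thus ?thesis by (metis Suc_eq_plus1 mult.commute power_Suc right_diff_distrib)
    qed
    moreover have "(1 / real m) ^ p * (1 / (real m * real (Suc m))) \<ge> (1 / real m) ^ p * ((1 / real m)\<^sup>2 / 2)"
    proof (rule mult_left_mono)
      have "real m * real (Suc m) \<le> 2 * (real m)\<^sup>2" "real m * real (Suc m) > 0"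
        using m1 by (auto simp: power2_eq_square algebra_simps intro: mult_mono add_pos_nonneg)
      hence "1 / (2 * (real m)\<^sup>2) \<le> 1 / (real m * real (Suc m))" by (intro frac_le) auto
      thus "(1 / real m)\<^sup>2 / 2 \<le> 1 / (real m * real (Suc m))" by (simp add: power_one_over)
    qed simp
    moreover have "(1 / real m) ^ p * ((1 / real m)\<^sup>2 / 2) = (1 / real m) ^ (p + 2) / 2"
      by (simp add: power_add power2_eq_square)
    moreover have "G \<le> 2 * (A - B)" if "B \<le> D" "A - D = E" "F \<le> E" "F = G / 2" for A B D E F G :: real
    proof -
      have "G = 2 * F" using that(4) by simp
      also have "\<dots> \<le> 2 * (A - B)" using that(1-3) by (intro mult_left_mono) linarith+
      finally show ?thesis .
    qed
    ultimately have "(1 / real m) ^ (p + 2) \<le> 2 * ((1 / real m) ^ (p + 1) - (1 / real (Suc m)) ^ (p + 1))"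
      by blast
    hence "C * (1 / real m) ^ (p + 2) \<le> C * (2 * ((1 / real m) ^ (p + 1) - (1 / real (Suc m)) ^ (p + 1)))"
      using C by (intro mult_left_mono)
    moreover have "\<bar>e (Suc m) - e m\<bar> \<le> C * (1 / real m) ^ (p + 2)" using diff m n by simp
    ultimately show ?thesis unfolding h_def by (simp add: algebra_simps del: power_Suc)
  qed
  hence "incseq (\<lambda>m. h (m + n))" by (intro incseq_SucI) auto
  moreover have "(\<lambda>m. h (m + n)) \<longlonglongrightarrow> 0 - 2 * C * 0 ^ (p + 1)"
    unfolding h_def
    by (intro LIMSEQ_ignore_initial_segment[where f = "\<lambda>m. e m - 2 * C * (1 / real m) ^ (p + 1)"]
        tendsto_intros lim lim_1_over_n)
  ultimately have "h (0 + n) \<le> 0 - 2 * C * 0 ^ (p + 1)" by (rule incseq_le)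
  thus ?thesis by (simp add: h_def)
qed

text \<open>The error \<open>e n\<close> of the truncated expansion tends to \<open>0\<close>, and its differences are the defect at \<open>1/n\<close>,
so they are \<open>O(n\<^bsup>-J-2\<^esup>)\<close>. Summing the differences from \<open>n\<close> to infinity yields \<open>O(n\<^bsup>-J-1\<^esup>)\<close>. The finitely
many \<open>n\<close> at which \<open>1/n\<close> is not small only enlarge the constant.\<close>

lemma lam_asymptotic_expansion:
  "\<exists>C. \<forall>n\<ge>1. \<bar>2 * lam n - 2 * ln (real n) - (4 * ln 2 + 2 * euler_mascheroni)
        - (\<Sum>k=1..J. S1 k * (1 / real n) ^ k)\<bar> \<le> C * (1 / real n) ^ (J + 1)"
proof -
  define e where "e n = 2 * lam n - 2 * ln (real n) - (4 * ln 2 + 2 * euler_mascheroni)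
        - (\<Sum>k=1..J. S1 k * (1 / real n) ^ k)" for n
  have step: "e (Suc n) - e n = lam_defect J (1 / real n)" if "n \<ge> 1" for n
  proof -
    have "lam (Suc n) - lam n = 2 / (2 * real n + 1)" by (simp add: lam_def)
    moreover have "4 * (1 / real n) / (2 + 1 / real n) = 4 / (2 * real n + 1)"
      using that by (simp add: field_simps)
    moreover have "ln (1 + 1 / real n) = ln (real (Suc n)) - ln (real n)"
    proof -
      have "1 + 1 / real n = real (Suc n) / real n" using that by (simp add: field_simps)
      thus ?thesis using that by (simp add: ln_div)
    qed
    moreover have "(1 / real n) / (1 + 1 / real n) = 1 / real (Suc n)"
      using that by (simp add: field_simps)
    ultimately show ?thesis
      unfolding e_def lam_defect_def by (simp add: sum_subtractf right_diff_distrib)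
  qed
  have "(\<lambda>n. 2 * (lam n - ln (real n)) - (4 * ln 2 + 2 * euler_mascheroni)
        - (\<Sum>k=1..J. S1 k * (1 / real n) ^ k)) \<longlonglongrightarrow>
        2 * (euler_mascheroni + 2 * ln 2) - (4 * ln 2 + 2 * euler_mascheroni) - (\<Sum>k=1..J. S1 k * 0 ^ k)"
    by (intro tendsto_intros lam_minus_ln_tendsto lim_1_over_n)
  moreover have "(\<Sum>k=1..J. S1 k * 0 ^ k) = 0" by (intro sum.neutral) auto
  ultimately have lim: "e \<longlonglongrightarrow> 0" by (simp add: e_def[abs_def] algebra_simps)
  obtain C d where C: "C \<ge> 0" "d > 0" "\<And>x. \<bar>x\<bar> < d \<Longrightarrow> \<bar>lam_defect J x\<bar> \<le> C * \<bar>x\<bar> ^ (J + 2)"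
    using lam_defect_bound[of J] by blast
  \<comment> \<open>From \<open>N\<close> on, \<open>1/n\<close> lies in the range of the bound for the defect.\<close>
  obtain N where N: "1 / d < real N" using reals_Archimedean2 by blast
  have N0: "N \<ge> 1" using N C(2) by (cases N) (auto simp: field_simps)
  have diff: "\<bar>e (Suc n) - e n\<bar> \<le> C * (1 / real n) ^ (J + 2)" if "n \<ge> N" for n
  proof -
    have "1 / d < real n" using N that by linarith
    hence "1 / real n < d" using C(2) that N0 by (simp add: field_simps)
    thus ?thesis using C(3)[of "1 / real n"] step[of n] that N0 by simp
  qed
  have bound: "\<bar>e n\<bar> \<le> 2 * C * (1 / real n) ^ (J + 1)" if "n \<ge> N" for n
  proof -
    have "e n \<le> 2 * C * (1 / real n) ^ (J + 1)"
      using that N0 by (intro null_sequence_bound_of_differences[OF lim C(1) diff]) auto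
    moreover have "- e n \<le> 2 * C * (1 / real n) ^ (J + 1)"
    proof (rule null_sequence_bound_of_differences[where N = N and e = "\<lambda>n. - e n"])
      show "(\<lambda>n. - e n) \<longlonglongrightarrow> 0" using tendsto_minus[OF lim] by simp
      show "\<bar>- e (Suc n) - - e n\<bar> \<le> C * (1 / real n) ^ (J + 2)" if "n \<ge> N" for n
        using diff[OF that] by (simp add: abs_minus_commute)
    qed (use that N0 C in auto)
    ultimately show ?thesis by linarith
  qed
  define C' where "C' = 2 * C + (\<Sum>n<N. \<bar>e n\<bar> * real n ^ (J + 1))"
  have "\<bar>e n\<bar> \<le> C' * (1 / real n) ^ (J + 1)" if "n \<ge> 1" for n
  proof (cases "n \<ge> N")
    case True
    have "2 * C \<le> C'" unfolding C'_def by (auto intro!: sum_nonneg)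
    hence "2 * C * (1 / real n) ^ (J + 1) \<le> C' * (1 / real n) ^ (J + 1)"
      by (intro mult_right_mono) auto
    thus ?thesis using bound[OF True] by linarith
  next
    case False
    have "\<bar>e n\<bar> * real n ^ (J + 1) \<le> (\<Sum>n<N. \<bar>e n\<bar> * real n ^ (J + 1))"
      using False by (intro member_le_sum) auto
    hence "\<bar>e n\<bar> * real n ^ (J + 1) \<le> C'" using C(1) by (simp add: C'_def)
    hence "(\<bar>e n\<bar> * real n ^ (J + 1)) * (1 / real n) ^ (J + 1) \<le> C' * (1 / real n) ^ (J + 1)"
      by (intro mult_right_mono) auto
    moreover have "(\<bar>e n\<bar> * real n ^ (J + 1)) * (1 / real n) ^ (J + 1) = \<bar>e n\<bar>"
      using that by (simp add: power_one_over del: power_Suc)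
    ultimately show ?thesis by simp
  qed
  thus ?thesis unfolding e_def by blast
qed

lemma powr_diff_nat:
  "n > 0 \<Longrightarrow> real n powr (x - real J - 1) = real n powr x * (1 / real n) ^ (J + 1)"
  using powr_diff[of "real n" x "real (J + 1)"] powr_realpow[of "real n" "J + 1"]
  by (simp add: power_one_over algebra_simps del: power_Suc)

lemma exp_lam_expansion:
  "\<exists>C\<ge>0. \<forall>n\<ge>1. \<forall>t::complex. norm t \<le> R \<longrightarrow>
     norm (exp (- 2 * of_real (lam n) * t) - exp (- of_real (4 * ln 2 + 2 * euler_mascheroni) * t) *
        (\<Sum>j\<le>J. p_poly j (\<lambda>k. of_real (S1 k)) t * of_nat n powr (- 2 * t - of_nat j)))
     \<le> C * real n powr (- 2 * Re t - real J - 1)"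
proof -
  define c :: real where "c = 4 * ln 2 + 2 * euler_mascheroni"
  define w :: "nat \<Rightarrow> complex" where "w n = of_real (2 * lam n - 2 * ln (real n) - c)" for n
  let ?s = "\<lambda>k. complex_of_real (S1 k)"
  obtain D where D: "\<And>n. n \<ge> 1 \<Longrightarrow> \<bar>2 * lam n - 2 * ln (real n) - c
        - (\<Sum>k=1..J. S1 k * (1 / real n) ^ k)\<bar> \<le> D * (1 / real n) ^ (J + 1)"
    using lam_asymptotic_expansion[of J] unfolding c_def by blast
  have w: "norm (w n - (\<Sum>k=1..J. ?s k * of_real (1 / real n) ^ k)) \<le> D * (1 / real n) ^ (J + 1)"
    if "n \<ge> 1" for n
  proof -
    have "w n - (\<Sum>k=1..J. ?s k * of_real (1 / real n) ^ k) =
          of_real (2 * lam n - 2 * ln (real n) - c - (\<Sum>k=1..J. S1 k * (1 / real n) ^ k))"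
      by (simp add: w_def)
    thus ?thesis using D[OF that] by (simp only: norm_of_real)
  qed
  obtain C where C: "C \<ge> 0" "\<And>n (t::complex). n \<ge> 1 \<Longrightarrow> norm t \<le> R \<Longrightarrow>
     norm (exp (- t * w n) - (\<Sum>j\<le>J. p_poly j ?s t * of_real (1 / real n) ^ j)) \<le> C * (1 / real n) ^ (J + 1)"
    using exp_asymptotic_expansion[where w = w and J = J and s = ?s and D = D and R = R] w by blast
  define B where "B = exp (\<bar>c\<bar> * \<bar>R\<bar>)"
  show ?thesis
  proof (intro exI[of _ "B * C"] conjI allI impI)
    show "0 \<le> B * C" using C by (simp add: B_def)
    fix n :: nat and t :: complex assume n: "n \<ge> 1" and t: "norm t \<le> R"
    define P where "P = exp (- of_real c * t) * of_nat n powr (- 2 * t)"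
    have "exp (- 2 * of_real (lam n) * t) = P * exp (- t * w n)"
      using n unfolding P_def w_def powr_def
      by (simp add: algebra_simps Ln_of_nat flip: exp_add)
    moreover have "exp (- of_real c * t) * (\<Sum>j\<le>J. p_poly j ?s t * of_nat n powr (- 2 * t - of_nat j))
        = P * (\<Sum>j\<le>J. p_poly j ?s t * of_real (1 / real n) ^ j)"
      using n by (simp add: P_def powr_diff powr_nat' sum_distrib_left power_one_over field_simps)
    ultimately have "norm (exp (- 2 * of_real (lam n) * t) - exp (- of_real c * t) *
        (\<Sum>j\<le>J. p_poly j ?s t * of_nat n powr (- 2 * t - of_nat j)))
       = norm P * norm (exp (- t * w n) - (\<Sum>j\<le>J. p_poly j ?s t * of_real (1 / real n) ^ j))"
      by (simp add: right_diff_distrib flip: norm_mult)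
    also have "\<dots> \<le> (B * real n powr (- 2 * Re t)) * (C * (1 / real n) ^ (J + 1))"
    proof (intro mult_mono C(2) n t)
      have "norm (exp (- of_real c * t)) \<le> B"
      proof -
        have "- c * Re t \<le> \<bar>c\<bar> * \<bar>Re t\<bar>"
          using abs_ge_self[of "- c * Re t"] by (simp add: abs_mult)
        also have "\<dots> \<le> \<bar>c\<bar> * \<bar>R\<bar>"
          using abs_Re_le_cmod[of t] t by (intro mult_left_mono) auto
        finally have "- c * Re t \<le> \<bar>c\<bar> * \<bar>R\<bar>" .
        thus ?thesis by (simp add: B_def)
      qed
      thus "norm P \<le> B * real n powr (- 2 * Re t)"
        using n by (simp add: P_def norm_mult norm_powr_real_powr' norm_powr_real_powr mult_right_mono)
    qed (auto simp: B_def)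
    also have "\<dots> = B * C * (real n powr (- 2 * Re t - real J - 1))"
      using n by (subst powr_diff_nat) (simp_all add: mult_ac)
    finally show "norm (exp (- 2 * of_real (lam n) * t) - exp (- of_real (4 * ln 2 + 2 * euler_mascheroni) * t) *
        (\<Sum>j\<le>J. p_poly j ?s t * of_nat n powr (- 2 * t - of_nat j)))
     \<le> B * C * real n powr (- 2 * Re t - real J - 1)" unfolding c_def .
  qed
qed

section \<open>Series in half-planes and shifted powers\<close>

text \<open>Termwise bounds of the order \<open>n\<close> to the power \<open>- \<kappa> Re s - b\<close>, uniform for bounded \<open>s\<close>, give locally uniform
convergence wherever the exponent is below \<open>-1\<close>. The bound starts at \<open>n = 2\<close> because it will come from
the binomial series in \<open>1/n\<close>, whose radius of convergence is 1.\<close>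

lemma half_plane_series:
  fixes f :: "nat \<Rightarrow> complex \<Rightarrow> complex" and \<kappa> b :: real
  assumes holo: "\<And>n. f (Suc n) holomorphic_on UNIV" and \<kappa>: "\<kappa> > 0"
    and bound: "\<And>R. \<exists>C. \<forall>n\<ge>2. \<forall>s. norm s \<le> R \<longrightarrow> norm (f n s) \<le> C * real n powr (- \<kappa> * Re s - b)"
  shows half_plane_series_holomorphic: "(\<lambda>s. \<Sum>n. f (Suc n) s) holomorphic_on {s. \<kappa> * Re s + b > 1}"
    and half_plane_series_summable: "\<kappa> * Re s + b > 1 \<Longrightarrow> summable (\<lambda>n. f (Suc n) s)"
proof -
  let ?S = "{s. \<kappa> * Re s + b > 1}"
  have open_S: "open ?S" by (intro open_Collect_less continuous_intros)
  have local: "\<exists>d>0. cball z d \<subseteq> ?S \<and> (\<exists>M. summable M \<and>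
      (\<forall>\<^sub>F n in sequentially. \<forall>s\<in>cball z d. norm (f (Suc n) s) \<le> M n))" if z: "z \<in> ?S" for z
  proof -
    define d where "d = (\<kappa> * Re z + b - 1) / (2 * \<kappa>)"
    have d: "d > 0" using z \<kappa> by (simp add: d_def)
    have kd: "\<kappa> * d = (\<kappa> * Re z + b - 1) / 2" using \<kappa> by (simp add: d_def)
    have Re_ge: "\<kappa> * Re s \<ge> \<kappa> * Re z - \<kappa> * d" if "s \<in> cball z d" for s
    proof -
      have "Re z - Re s \<le> d"
        using that abs_Re_le_cmod[of "z - s"] by (simp add: dist_norm)
      hence "\<kappa> * (Re z - Re s) \<le> \<kappa> * d" using \<kappa> by (intro mult_left_mono) auto
      thus ?thesis by (simp add: algebra_simps)
    qed
    \<comment> \<open>The radius \<open>d\<close> uses up half of the distance to the boundary; \<open>\<eta>\<close> is the worst exponent.\<close>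
    define \<eta> where "\<eta> = \<kappa> * Re z - \<kappa> * d + b"
    have \<eta>: "\<eta> > 1" using z kd by (simp add: \<eta>_def)
    obtain C where C: "\<And>n s. n \<ge> 2 \<Longrightarrow> norm s \<le> norm z + d \<Longrightarrow> norm (f n s) \<le> C * real n powr (- \<kappa> * Re s - b)"
      using bound[of "norm z + d"] by blast
    have "norm (f (Suc n) s) \<le> \<bar>C\<bar> * real (Suc n) powr (- \<eta>)"
      if n: "n \<ge> 1" and s: "s \<in> cball z d" for n s
    proof -
      have "norm s \<le> norm z + d"
        using s norm_triangle_ineq2[of s z] by (simp add: dist_norm norm_minus_commute)
      hence "norm (f (Suc n) s) \<le> C * real (Suc n) powr (- \<kappa> * Re s - b)" using n by (intro C) auto
      also have "\<dots> \<le> \<bar>C\<bar> * real (Suc n) powr (- \<eta>)"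
        using Re_ge[OF s] n by (intro mult_mono powr_mono) (auto simp: \<eta>_def)
      finally show ?thesis .
    qed
    hence "\<forall>\<^sub>F n in sequentially. \<forall>s\<in>cball z d. norm (f (Suc n) s) \<le> \<bar>C\<bar> * real (Suc n) powr (- \<eta>)"
      by (intro eventually_mono[OF eventually_ge_at_top[of 1]] ballI) auto
    moreover have "summable (\<lambda>n. \<bar>C\<bar> * real (Suc n) powr (- \<eta>))"
      using \<eta> by (intro summable_mult, subst summable_Suc_iff) (simp add: summable_real_powr_iff)
    moreover have "cball z d \<subseteq> ?S" using Re_ge \<eta> by (force simp: \<eta>_def)
    ultimately show ?thesis using d by blast
  qed
  show "(\<lambda>s. \<Sum>n. f (Suc n) s) holomorphic_on ?S"
  proof (rule holomorphic_uniform_sequence[OF open_S, where f = "\<lambda>N s. \<Sum>n<N. f (Suc n) s"])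
    show "(\<lambda>s. \<Sum>n<N. f (Suc n) s) holomorphic_on ?S" for N
      by (intro holomorphic_on_sum holomorphic_on_subset[OF holo]) auto
    fix z assume "z \<in> ?S"
    from local[OF this] obtain d M where dM: "d > 0" "cball z d \<subseteq> ?S" "summable M"
      "\<forall>\<^sub>F n in sequentially. \<forall>s\<in>cball z d. norm (f (Suc n) s) \<le> M n" by blast
    have "uniform_limit (cball z d) (\<lambda>N s. \<Sum>n<N. f (Suc n) s) (\<lambda>s. \<Sum>n. f (Suc n) s) sequentially"
      by (rule Weierstrass_m_test_ev[OF dM(4,3)])
    thus "\<exists>d>0. cball z d \<subseteq> ?S \<and> uniform_limit (cball z d) (\<lambda>N s. \<Sum>n<N. f (Suc n) s) (\<lambda>s. \<Sum>n. f (Suc n) s) sequentially"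
      using dM by blast
  qed
  show "summable (\<lambda>n. f (Suc n) s)" if "\<kappa> * Re s + b > 1"
  proof -
    from that local[of s] obtain d M where dM: "d > 0" "summable M"
      "\<forall>\<^sub>F n in sequentially. \<forall>s'\<in>cball s d. norm (f (Suc n) s') \<le> M n" by blast
    show ?thesis
    proof (rule summable_comparison_test_ev[OF _ dM(2)])
      show "\<forall>\<^sub>F n in sequentially. norm (f (Suc n) s) \<le> M n"
        using dM(3) by eventually_elim (use dM(1) in auto)
    qed
  qed
qed

text \<open>Each factor \<open>a - j\<close> of the binomial coefficient is at most \<open>R + j = \<bar>- R - j\<bar>\<close> in modulus, so one
convergent binomial series majorizes those of all exponents with \<open>\<bar>a\<bar> \<le> R\<close>.\<close>

lemma norm_gbinomial_le:
  fixes a :: complex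
  assumes "norm a \<le> R"
  shows "norm (a gchoose i) \<le> norm ((- R :: real) gchoose i)"
proof -
  have "(\<Prod>j = 0..<i. norm (a - of_nat j)) \<le> (\<Prod>j = 0..<i. norm (- R - of_nat j))"
  proof (rule prod_mono)
    fix j assume "j \<in> {0..<i}"
    have "norm (a - of_nat j) \<le> norm a + real j"
      using norm_triangle_ineq4[of a "of_nat j"] by simp
    also have "\<dots> \<le> norm (- R - of_nat j)" using assms by simp
    finally show "0 \<le> norm (a - of_nat j) \<and> norm (a - of_nat j) \<le> norm (- R - of_nat j)" by simp
  qed
  thus ?thesis
    by (simp add: gbinomial_prod_rev norm_divide divide_right_mono abs_prod flip: prod_norm)
qed

text \<open>The remainder in the expansion of \<open>(n + 1)\<^sup>a = n\<^sup>a (1 + 1/n)\<^sup>a\<close> by the binomial series.\<close>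

definition shift_remainder :: "nat \<Rightarrow> complex \<Rightarrow> nat \<Rightarrow> complex" where
  "shift_remainder J a n =
     of_nat (Suc n) powr a - (\<Sum>j\<le>J. (a gchoose j) * of_nat n powr (a - of_nat j))"

lemma shift_remainder_bound:
  "\<exists>C. \<forall>n\<ge>2. \<forall>a. norm a \<le> R \<longrightarrow>
     norm (shift_remainder J a n) \<le> C * real n powr (Re a - real J - 1)"
proof -
  define g where "g i = norm ((- R :: real) gchoose i)" for i
  have "ereal (norm (1/2 :: real)) < conv_radius (\<lambda>i. (- R :: real) gchoose i)"
    by (auto simp: conv_radius_gchoose)
  from abs_summable_in_conv_radius[OF this] have "summable (\<lambda>i. g i * (1/2) ^ i)"
    by (simp add: g_def abs_mult power_abs)
  hence "summable (\<lambda>i. g (i + (J + 1)) * (1/2) ^ (i + (J + 1)))"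
    by (rule summable_ignore_initial_segment)
  hence "summable (\<lambda>i. 2 ^ (J + 1) * (g (i + (J + 1)) * (1/2) ^ (i + (J + 1))))" by (rule summable_mult)
  also have "(\<lambda>i. 2 ^ (J + 1) * (g (i + (J + 1)) * (1/2) ^ (i + (J + 1)))) = (\<lambda>i. g (i + (J + 1)) * (1/2) ^ i)"
    by (auto simp: fun_eq_iff power_add power_one_over)
  finally have sm: "summable (\<lambda>i. g (i + (J + 1)) * (1/2) ^ i)" .
  define C where "C = (\<Sum>i. g (i + (J + 1)) * (1/2) ^ i)"
  show ?thesis
  proof (intro exI[of _ C] allI impI)
    fix n :: nat and a :: complex assume n: "n \<ge> 2" and a: "norm a \<le> R"
    define x where "x = 1 / real n"
    have x: "0 \<le> x" "x \<le> 1/2" using n by (auto simp: x_def field_simps)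
    define y where "y = complex_of_real x"
    have ny: "norm y = x" using x by (simp add: y_def)
    have "(\<lambda>i. (a gchoose i) * y ^ i) sums (1 + y) powr a"
      using x ny by (intro gen_binomial_complex) auto
    hence "(\<lambda>i. (a gchoose (i + (J + 1))) * y ^ (i + (J + 1))) sums
        ((1 + y) powr a - (\<Sum>i<J+1. (a gchoose i) * y ^ i))"
      by (rule sums_split_initial_segment)
    hence sum_eq: "(1 + y) powr a - (\<Sum>j\<le>J. (a gchoose j) * y ^ j) =
        (\<Sum>i. (a gchoose (i + (J + 1))) * y ^ (i + (J + 1)))"
      by (simp add: sums_iff lessThan_Suc_atMost)
    have "norm (\<Sum>i. (a gchoose (i + (J + 1))) * y ^ (i + (J + 1))) \<le> (\<Sum>i. x ^ (J + 1) * (g (i + (J + 1)) * (1/2) ^ i))"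
    proof (rule norm_suminf_le)
      fix i
      have "norm ((a gchoose (i + (J + 1))) * y ^ (i + (J + 1))) = norm (a gchoose (i + (J + 1))) * (x ^ i * x ^ (J + 1))"
        by (simp add: norm_mult norm_power ny power_add)
      also have "\<dots> \<le> g (i + (J + 1)) * ((1/2) ^ i * x ^ (J + 1))"
        unfolding g_def using x
        by (intro mult_mono norm_gbinomial_le a power_mono) (auto simp del: power_Suc)
      finally show "norm ((a gchoose (i + (J + 1))) * y ^ (i + (J + 1))) \<le> x ^ (J + 1) * (g (i + (J + 1)) * (1/2) ^ i)"
        by (simp add: mult_ac)
    qed (intro summable_mult sm)
    also have "\<dots> = x ^ (J + 1) * C" unfolding C_def using sm by (rule suminf_mult)
    finally have main: "norm ((1 + y) powr a - (\<Sum>j\<le>J. (a gchoose j) * y ^ j)) \<le> C * x ^ (J + 1)"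
      unfolding sum_eq by (simp add: mult.commute)
    have n0: "of_nat n \<noteq> (0::complex)" using n by auto
    have "of_nat (Suc n) = of_nat n * (1 + y)"
      using n by (simp add: y_def x_def field_simps)
    moreover have "(of_nat n * (1 + y)) powr a = of_nat n powr a * (1 + y) powr a"
      using x by (intro powr_times_real) (auto simp: y_def)
    moreover have "(\<Sum>j\<le>J. (a gchoose j) * of_nat n powr (a - of_nat j)) = of_nat n powr a * (\<Sum>j\<le>J. (a gchoose j) * y ^ j)"
      unfolding sum_distrib_left using n0
      by (intro sum.cong refl) (simp add: powr_diff powr_nat' y_def x_def power_one_over field_simps)
    ultimately have "shift_remainder J a n = of_nat n powr a * ((1 + y) powr a - (\<Sum>j\<le>J. (a gchoose j) * y ^ j))"
      unfolding shift_remainder_def by (simp only: right_diff_distrib)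
    hence "norm (shift_remainder J a n) \<le> real n powr (Re a) * (C * x ^ (J + 1))"
      using main by (simp add: norm_mult norm_powr_real_powr mult_left_mono)
    also have "\<dots> = C * real n powr (Re a - real J - 1)"
      using n unfolding x_def by (subst powr_diff_nat) (simp_all add: mult_ac)
    finally show "norm (shift_remainder J a n) \<le> C * real n powr (Re a - real J - 1)" .
  qed
qed

lemma holomorphic_on_gbinomial [holomorphic_intros]:
  "f holomorphic_on A \<Longrightarrow> (\<lambda>s. f s gchoose j) holomorphic_on A"
  unfolding gbinomial_prod_rev by (intro holomorphic_intros) auto

lemma holomorphic_shift_remainder:
  "f holomorphic_on A \<Longrightarrow> (\<lambda>s. shift_remainder J (f s) (Suc n)) holomorphic_on A"
  unfolding shift_remainder_def by (intro holomorphic_intros) auto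

lemma shift_expansion:
  "of_nat (Suc n) powr a - of_nat n powr a =
     (\<Sum>j\<in>{1..J}. (a gchoose j) * of_nat n powr (a - of_nat j)) + shift_remainder J a n"
  by (simp add: shift_remainder_def sum.atLeast0_atMost_Suc_shift atMost_atLeast0 sum.atLeast_Suc_atMost)

lemma norm_of_nat_powr: "n > 0 \<Longrightarrow> norm (of_nat n powr s :: complex) = real n powr Re s"
  by (simp add: norm_powr_real_powr)

lemma of_nat_powr_tendsto_0:
  assumes "Re s > 0"
  shows "(\<lambda>n. of_nat (Suc n) powr (- s) :: complex) \<longlonglongrightarrow> 0"
proof (rule tendsto_norm_zero_cancel)
  have "(\<lambda>n. real (Suc n) powr (- Re s)) \<longlonglongrightarrow> 0"
    using assms by (intro LIMSEQ_Suc tendsto_neg_powr filterlim_real_sequentially) auto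
  thus "(\<lambda>n. norm (of_nat (Suc n) powr (- s) :: complex)) \<longlonglongrightarrow> 0"
    by (simp only: norm_of_nat_powr[OF zero_less_Suc] uminus_complex.sel)
qed

section \<open>The zeta function and the polylogarithm\<close>

text \<open>The function \<open>Z(s) = (s - 1) \<zeta>(s)\<close> is continued by one unit to the left at a time. For \<open>Re s > 1\<close> the
differences \<open>(n + 1)\<^bsup>1-s\<^esup> - n\<^bsup>1-s\<^esup>\<close> sum up to \<open>-1\<close>. Expanding them by the binomial series gives
\<open>-1 = (1 - s) \<zeta>(s) + \<Sum>j\<ge>2. (1-s choose j) \<zeta>(s + j - 1) + \<dots>\<close>, so \<open>Z(s)\<close> is expressed by values of \<open>\<zeta>\<close>
further to the right and a remainder that is holomorphic in a larger half-plane. No new poles arise: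
the binomial coefficient contains the factor \<open>s + j - 2\<close>, which turns \<open>\<zeta>(s + j - 1)\<close> into
\<open>Z(s + j - 1)\<close>. The remaining product contains \<open>1 - s\<close>, whence \<open>Z(1) = 1\<close>.\<close>

theorem zeta_continuation:
  "\<exists>Z. Z holomorphic_on {s. Re s > 1 - real N} \<and> (N \<ge> 1 \<longrightarrow> Z 1 = 1) \<and>
       (\<forall>s. Re s > 1 \<longrightarrow> (\<lambda>n. of_nat (Suc n) powr (- s)) sums (Z s / (s - 1)))"
proof (induction N)
  case 0
  have *: "(\<lambda>s. of_nat (Suc n) powr (- s) :: complex) holomorphic_on UNIV" for n
    by (intro holomorphic_intros)
  have bd: "\<exists>C. \<forall>n\<ge>2. \<forall>s. norm s \<le> R \<longrightarrow> norm (of_nat n powr (- s) :: complex) \<le> C * real n powr (- 1 * Re s - 0)" for R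
    by (intro exI[of _ 1]) (auto simp: norm_powr_real_powr)
  note series = half_plane_series[where f = "\<lambda>n s. of_nat n powr (- s)" and \<kappa> = 1 and b = 0, OF * _ bd]
  have "(\<lambda>s::complex. \<Sum>n. of_nat (Suc n) powr (- s)) holomorphic_on {s. Re s > 1}"
    using series(1) by simp
  moreover have "(\<lambda>n. of_nat (Suc n) powr (- s)) sums (\<Sum>n. of_nat (Suc n) powr (- s) :: complex)"
    if "Re s > 1" for s
    using series(2)[of s] that by (simp add: summable_sums)
  ultimately show ?case
    by (intro exI[of _ "\<lambda>s. (s - 1) * (\<Sum>n. of_nat (Suc n) powr (- s))"] conjI)
       (auto intro!: holomorphic_intros)
next
  case (Suc N)
  then obtain Z where Z: "Z holomorphic_on {s. Re s > 1 - real N}"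
    "\<And>s. Re s > 1 \<Longrightarrow> (\<lambda>n. of_nat (Suc n) powr (- s)) sums (Z s / (s - 1))" by blast
  define r where "r n s = shift_remainder (N + 1) (1 - s) n" for n s
  have holo_r: "r (Suc n) holomorphic_on UNIV" for n
    unfolding r_def[abs_def] by (intro holomorphic_shift_remainder holomorphic_intros)
  have bound_r: "\<exists>C. \<forall>n\<ge>2. \<forall>s. norm s \<le> R \<longrightarrow> norm (r n s) \<le> C * real n powr (- 1 * Re s - (real N + 1))" for R
  proof -
    obtain C where C: "\<And>n a. n \<ge> 2 \<Longrightarrow> norm a \<le> 1 + R \<Longrightarrow>
       norm (shift_remainder (N + 1) a n) \<le> C * real n powr (Re a - real (N + 1) - 1)"
      using shift_remainder_bound[of "1 + R" "N + 1"] by blast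
    show ?thesis
    proof (intro exI[of _ C] allI impI)
      fix n :: nat and s :: complex assume n: "n \<ge> 2" and s: "norm s \<le> R"
      have "norm (1 - s) \<le> 1 + R" using s norm_triangle_ineq4[of 1 s] by simp
      from C[OF n this] show "norm (r n s) \<le> C * real n powr (- 1 * Re s - (real N + 1))"
        by (simp add: r_def diff_diff_eq)
    qed
  qed
  note series = half_plane_series[where f = r and \<kappa> = 1 and b = "real N + 1", OF holo_r _ bound_r]
  define G where "G s = 1 + (\<Sum>k<N. - (\<Prod>i<Suc k. 1 - s - of_nat i) / fact (k + 2) * Z (s + of_nat (k + 1)))
      + (\<Sum>n. r (Suc n) s)" for s
  have "G holomorphic_on {s. Re s > 1 - real (Suc N)}"
  proof -
    have "(\<lambda>s. Z (s + of_nat (k + 1))) holomorphic_on {s. Re s > - real N}" for k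
    proof (rule holomorphic_on_compose_gen[unfolded o_def, OF _ Z(1)])
      show "(\<lambda>s. s + of_nat (k + 1)) holomorphic_on {s. Re s > - real N}" by (intro holomorphic_intros)
    qed auto
    moreover have "(\<lambda>s. \<Sum>n. r (Suc n) s) holomorphic_on {s. Re s > - real N}"
    proof -
      have "{s. Re s > - real N} = {s. 1 * Re s + (real N + 1) > 1}" by auto
      thus ?thesis using series(1) by (simp only: zero_less_one)
    qed
    ultimately show ?thesis unfolding G_def[abs_def] by (auto intro!: holomorphic_intros)
  qed
  moreover have "G 1 = 1"
  proof -
    have "(\<Prod>i<Suc k. 1 - 1 - of_nat i) = (0::complex)" for k by (rule prod_zero) auto
    moreover have "r (Suc n) 1 = 0" for n
    proof -
      have "(0 gchoose j) * of_nat (Suc n) powr (0 - of_nat j) = (if j = 0 then 1 else 0 :: complex)" for j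
        by (cases j) (auto simp: gbinomial_0_left simp del: of_nat_Suc)
      moreover have "of_nat (Suc (Suc n)) \<noteq> (0 :: complex)" by (simp only: of_nat_neq_0 not_False_eq_True)
      ultimately show ?thesis by (simp add: r_def shift_remainder_def del: of_nat_Suc)
    qed
    ultimately show ?thesis
      unfolding G_def by (simp only: minus_zero div_0 mult_zero_left sum.neutral_const suminf_zero add_0_right)
  qed
  moreover have "(\<lambda>n. of_nat (Suc n) powr (- s)) sums (G s / (s - 1))" if s: "Re s > 1" for s
  proof -
    let ?zeta = "\<lambda>s. Z s / (s - 1)"
    have "(\<lambda>n. of_nat (Suc (Suc n)) powr (1 - s) - of_nat (Suc n) powr (1 - s)) sums (0 - of_nat (Suc 0) powr (1 - s))"
      using of_nat_powr_tendsto_0[of "s - 1"] s by (intro telescope_sums) auto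
    hence tele: "(\<lambda>n. of_nat (Suc (Suc n)) powr (1 - s) - of_nat (Suc n) powr (1 - s)) sums (- 1)" by simp
    have "(\<lambda>n. (\<Sum>j\<in>{1..N+1}. ((1 - s) gchoose j) * of_nat (Suc n) powr (- (s + of_nat (j - 1)))) + r (Suc n) s) sums
       ((\<Sum>j\<in>{1..N+1}. ((1 - s) gchoose j) * ?zeta (s + of_nat (j - 1))) + (\<Sum>n. r (Suc n) s))"
      using s series(2)[of s] by (intro sums_add sums_sum sums_mult Z(2) summable_sums) auto
    also have "(\<lambda>n. (\<Sum>j\<in>{1..N+1}. ((1 - s) gchoose j) * of_nat (Suc n) powr (- (s + of_nat (j - 1)))) + r (Suc n) s)
       = (\<lambda>n. of_nat (Suc (Suc n)) powr (1 - s) - of_nat (Suc n) powr (1 - s))"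
    proof
      fix n
      have "(\<Sum>j\<in>{1..N+1}. ((1 - s) gchoose j) * of_nat (Suc n) powr (- (s + of_nat (j - 1))))
          = (\<Sum>j\<in>{1..N+1}. ((1 - s) gchoose j) * of_nat (Suc n) powr (1 - s - of_nat j))"
        by (intro sum.cong refl) (auto simp: of_nat_diff algebra_simps)
      thus "(\<Sum>j\<in>{1..N+1}. ((1 - s) gchoose j) * of_nat (Suc n) powr (- (s + of_nat (j - 1)))) + r (Suc n) s
         = of_nat (Suc (Suc n)) powr (1 - s) - of_nat (Suc n) powr (1 - s)"
        unfolding r_def by (subst shift_expansion[where J = "N + 1"]) simp
    qed
    finally have eq: "(\<Sum>j\<in>{1..N+1}. ((1 - s) gchoose j) * ?zeta (s + of_nat (j - 1))) + (\<Sum>n. r (Suc n) s) = - 1"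
      using tele sums_unique2 by blast
    have "(\<Sum>j\<in>{1..N+1}. ((1 - s) gchoose j) * ?zeta (s + of_nat (j - 1)))
        = (1 - s) * ?zeta s + (\<Sum>j\<in>{2..N+1}. ((1 - s) gchoose j) * ?zeta (s + of_nat (j - 1)))"
      by (subst sum.atLeast_Suc_atMost) (auto simp: numeral_2_eq_2)
    also have "(1 - s) * ?zeta s = - Z s"
    proof -
      have "s - 1 \<noteq> 0" using s by auto
      moreover have "(1 - s) * ?zeta s = - ((s - 1) * ?zeta s)"
        by (simp only: mult_minus_left[symmetric] minus_diff_eq)
      ultimately show ?thesis by (simp only: times_divide_eq_right nonzero_mult_div_cancel_left not_False_eq_True)
    qed
    also have "(\<Sum>j\<in>{2..N+1}. ((1 - s) gchoose j) * ?zeta (s + of_nat (j - 1)))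
        = (\<Sum>k<N. ((1 - s) gchoose (k + 2)) * ?zeta (s + of_nat (k + 1)))"
      by (rule sum.reindex_bij_witness[of _ "\<lambda>k. k + 2" "\<lambda>j. j - 2"]) (auto simp: Suc_diff_Suc numeral_2_eq_2)
    also have "\<dots> = (\<Sum>k<N. - (\<Prod>i<Suc k. 1 - s - of_nat i) / fact (k + 2) * Z (s + of_nat (k + 1)))"
    proof (rule sum.cong[OF refl])
      fix k
      have a: "((1 - s) gchoose (k + 2)) = (\<Prod>i<Suc k. 1 - s - of_nat i) * (1 - s - of_nat (Suc k)) / fact (k + 2)"
        by (simp add: gbinomial_prod_rev atLeast0LessThan)
      have b: "1 - s - of_nat (Suc k) = - (s + of_nat (k + 1) - 1)" by simp
      have nz: "s + of_nat (k + 1) - 1 \<noteq> 0"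
      proof
        assume "s + of_nat (k + 1) - 1 = 0"
        hence "Re (s + of_nat (k + 1) - 1) = 0" by simp
        thus False using s by simp
      qed
      have "(W * (- d) / F) * (x / d) = - W / F * x" if "d \<noteq> 0" for W d F x :: complex
        using that by simp
      from this[OF nz] show "((1 - s) gchoose (k + 2)) * ?zeta (s + of_nat (k + 1))
         = - (\<Prod>i<Suc k. 1 - s - of_nat i) / fact (k + 2) * Z (s + of_nat (k + 1))"
        unfolding a b .
    qed
    finally have split: "(\<Sum>j\<in>{1..N+1}. ((1 - s) gchoose j) * ?zeta (s + of_nat (j - 1))) =
      - Z s + (\<Sum>k<N. - (\<Prod>i<Suc k. 1 - s - of_nat i) / fact (k + 2) * Z (s + of_nat (k + 1)))" .
    have "x = 1 + q + y" if "- x + q + y = - 1" for x q y :: complex using that by algebra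
    from this[OF eq[unfolded split]] have "Z s = G s" unfolding G_def .
    thus ?thesis using Z(2)[OF s] by simp
  qed
  ultimately show ?case by (intro exI[of _ G]) auto
qed

text \<open>For \<open>z \<noteq> 1\<close> on the unit circle, summation by parts gives
\<open>(1 - z) \<Sum>n. z\<^sup>n n\<^bsup>-s\<^esup> = z + z \<Sum>n. z\<^sup>n ((n + 1)\<^bsup>-s\<^esup> - n\<^bsup>-s\<^esup>)\<close>. Expanding the differences by the binomial
series expresses the sum by its values at \<open>s + 1, s + 2, \<dots>\<close> and a remainder, as for the zeta
function, but with the nonzero factor \<open>1 - z\<close> in place of \<open>1 - s\<close>, so that there is no pole at all.
The first step also shows that the conditionally convergent series does converge for \<open>Re s > 0\<close>.\<close>

theorem polylog_continuation:
  fixes z :: complex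
  assumes z: "norm z = 1" "z \<noteq> 1"
  shows "\<exists>P. P holomorphic_on {s. Re s > - real N} \<and>
       (\<forall>s. Re s > 0 \<longrightarrow> (\<lambda>n. z ^ Suc n * of_nat (Suc n) powr (- s)) sums P s)"
proof -
  have z0: "z \<noteq> 0" using z by auto
  define r where "r J n s = z ^ n * shift_remainder J (- s) n" for J n s
  have holo_r: "r J (Suc n) holomorphic_on UNIV" for J n
    unfolding r_def[abs_def] by (intro holomorphic_intros holomorphic_shift_remainder)
  have bound_r: "\<exists>C. \<forall>n\<ge>2. \<forall>s. norm s \<le> R \<longrightarrow> norm (r J n s) \<le> C * real n powr (- 1 * Re s - (real J + 1))" for R J
  proof -
    obtain C where C: "\<And>n a. n \<ge> 2 \<Longrightarrow> norm a \<le> R \<Longrightarrow>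
       norm (shift_remainder J a n) \<le> C * real n powr (Re a - real J - 1)"
      using shift_remainder_bound[of R J] by blast
    show ?thesis
    proof (intro exI[of _ C] allI impI)
      fix n :: nat and s :: complex assume n: "n \<ge> 2" and s: "norm s \<le> R"
      from C[OF n, of "- s"] s show "norm (r J n s) \<le> C * real n powr (- 1 * Re s - (real J + 1))"
        by (simp add: r_def norm_mult norm_power z diff_diff_eq)
    qed
  qed
  have series: "(\<lambda>s. \<Sum>n. r J (Suc n) s) holomorphic_on {s. Re s > - real J}"
    "Re s > - real J \<Longrightarrow> summable (\<lambda>n. r J (Suc n) s)" for J s
  proof -
    have "{s. Re s > - real J} = {s. 1 * Re s + (real J + 1) > 1}" by auto
    thus "(\<lambda>s. \<Sum>n. r J (Suc n) s) holomorphic_on {s. Re s > - real J}"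
      using half_plane_series_holomorphic[where f = "r J" and \<kappa> = 1 and b = "real J + 1", OF holo_r _ bound_r]
      by (simp only: zero_less_one)
    show "summable (\<lambda>n. r J (Suc n) s)" if "Re s > - real J"
      using half_plane_series_summable[where f = "r J" and \<kappa> = 1 and b = "real J + 1", OF holo_r _ bound_r, of s] that
      by simp
  qed
  let ?a = "\<lambda>s n. z ^ Suc n * of_nat (Suc n) powr (- s)"
  have abel: "(\<lambda>n. z ^ Suc n * (of_nat (Suc (Suc n)) powr (- s) - of_nat (Suc n) powr (- s))) sums D \<longleftrightarrow>
        ?a s sums ((z + z * D) / (1 - z))" if s: "Re s > 0" for s D
  proof -
    let ?S = "\<lambda>N. \<Sum>n<N. ?a s n"
    let ?T = "\<lambda>N. \<Sum>n<N. z ^ Suc n * (of_nat (Suc (Suc n)) powr (- s) - of_nat (Suc n) powr (- s))"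
    \<comment> \<open>Partial sums satisfy the summation by parts exactly, up to a boundary term that tends to \<open>0\<close>.\<close>
    have parts: "(1 - z) * (\<Sum>n<N. z ^ Suc n * b n) =
        z * b 0 + z * (\<Sum>n<N. z ^ Suc n * (b (Suc n) - b n)) - z ^ Suc N * b N" for N and b :: "nat \<Rightarrow> complex"
    proof (induction N)
      case (Suc N)
      show ?case unfolding sum.lessThan_Suc distrib_left Suc.IH by (simp add: algebra_simps)
    qed simp
    have id: "(1 - z) * ?S N = z + z * ?T N - ?a s N" for N
      using parts[where b = "\<lambda>n. of_nat (Suc n) powr (- s)"] by simp
    have a0: "?a s \<longlonglongrightarrow> 0"
    proof (rule tendsto_norm_zero_cancel)
      have "(\<lambda>n. norm (of_nat (Suc n) powr (- s) :: complex)) \<longlonglongrightarrow> 0"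
        using tendsto_norm[OF of_nat_powr_tendsto_0[OF s]] by simp
      thus "(\<lambda>n. norm (?a s n)) \<longlonglongrightarrow> 0" by (simp only: norm_mult norm_power z power_one mult_1)
    qed
    have z1: "1 - z \<noteq> 0" using z by simp
    have S_eq: "?S N = (z + z * ?T N - ?a s N) / (1 - z)" for N
      unfolding id[symmetric] by (rule nonzero_mult_div_cancel_left[OF z1, symmetric])
    have T_eq: "?T N = ((1 - z) * ?S N + ?a s N - z) / z" for N
    proof -
      have e: "(1 - z) * ?S N + ?a s N - z = z * ?T N" unfolding id by simp
      show ?thesis unfolding e by (rule nonzero_mult_div_cancel_left[OF z0, symmetric])
    qed
    show ?thesis
    proof
      assume "(\<lambda>n. z ^ Suc n * (of_nat (Suc (Suc n)) powr (- s) - of_nat (Suc n) powr (- s))) sums D"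
      hence "?T \<longlonglongrightarrow> D" by (simp only: sums_def)
      hence "(\<lambda>N. (z + z * ?T N - ?a s N) / (1 - z)) \<longlonglongrightarrow> (z + z * D - 0) / (1 - z)"
        using a0 z1 by (intro tendsto_intros)
      hence "?S \<longlonglongrightarrow> (z + z * D) / (1 - z)" by (simp only: S_eq diff_zero)
      thus "?a s sums ((z + z * D) / (1 - z))" by (simp only: sums_def)
    next
      assume "?a s sums ((z + z * D) / (1 - z))"
      hence "?S \<longlonglongrightarrow> (z + z * D) / (1 - z)" by (simp only: sums_def)
      hence "(\<lambda>N. ((1 - z) * ?S N + ?a s N - z) / z) \<longlonglongrightarrow> ((1 - z) * ((z + z * D) / (1 - z)) + 0 - z) / z"
        using a0 z0 by (intro tendsto_intros)
      hence "?T \<longlonglongrightarrow> ((1 - z) * ((z + z * D) / (1 - z)) + 0 - z) / z" by (simp only: T_eq)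
      moreover have "((1 - z) * ((z + z * D) / (1 - z)) + 0 - z) / z = D" using z0 z1 by simp
      ultimately show "(\<lambda>n. z ^ Suc n * (of_nat (Suc (Suc n)) powr (- s) - of_nat (Suc n) powr (- s))) sums D"
        by (simp only: sums_def)
    qed
  qed
  show ?thesis
  proof (induction N)
    case 0
    define G where "G s = (z + z * (\<Sum>n. r 0 (Suc n) s)) / (1 - z)" for s
    have "G holomorphic_on {s. Re s > - real 0}"
      unfolding G_def[abs_def] using series(1)[of 0] z by (intro holomorphic_intros) auto
    moreover have "?a s sums G s" if "Re s > 0" for s
    proof -
      have "(\<lambda>n. r 0 (Suc n) s) = (\<lambda>n. z ^ Suc n * (of_nat (Suc (Suc n)) powr (- s) - of_nat (Suc n) powr (- s)))"
        by (simp add: r_def shift_remainder_def)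
      thus ?thesis using series(2)[of 0 s] that unfolding G_def
        by (subst abel[OF that, symmetric]) (auto dest: summable_sums)
    qed
    ultimately show ?case by (intro exI[of _ G]) auto
  next
    case (Suc N)
    then obtain P where P: "P holomorphic_on {s. Re s > - real N}" "\<And>s. Re s > 0 \<Longrightarrow> ?a s sums P s" by blast
    define J where "J = Suc N"
    define G where "G s = (z + z * ((\<Sum>j\<in>{1..J}. ((- s) gchoose j) * P (s + of_nat j)) + (\<Sum>n. r J (Suc n) s))) / (1 - z)" for s
    have "(\<lambda>s. P (s + of_nat j)) holomorphic_on {s. Re s > - real J}" if "j \<in> {1..J}" for j
    proof (rule holomorphic_on_compose_gen[unfolded o_def, OF _ P(1)])
      show "(\<lambda>s. s + of_nat j) holomorphic_on {s. Re s > - real J}" by (intro holomorphic_intros)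
    qed (use that in \<open>auto simp: J_def\<close>)
    hence "G holomorphic_on {s. Re s > - real J}"
      unfolding G_def[abs_def] using series(1)[of J] z by (intro holomorphic_intros) auto
    moreover have "?a s sums G s" if s: "Re s > 0" for s
    proof -
      have "(\<lambda>n. (\<Sum>j\<in>{1..J}. ((- s) gchoose j) * ?a (s + of_nat j) n) + r J (Suc n) s) sums
         ((\<Sum>j\<in>{1..J}. ((- s) gchoose j) * P (s + of_nat j)) + (\<Sum>n. r J (Suc n) s))"
        using s series(2)[of J s] by (intro sums_add sums_sum sums_mult P(2) summable_sums) auto
      also have "(\<lambda>n. (\<Sum>j\<in>{1..J}. ((- s) gchoose j) * ?a (s + of_nat j) n) + r J (Suc n) s)
        = (\<lambda>n. z ^ Suc n * (of_nat (Suc (Suc n)) powr (- s) - of_nat (Suc n) powr (- s)))"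
      proof
        fix n
        have "(\<Sum>j\<in>{1..J}. ((- s) gchoose j) * ?a (s + of_nat j) n) =
              z ^ Suc n * (\<Sum>j\<in>{1..J}. ((- s) gchoose j) * of_nat (Suc n) powr (- s - of_nat j))"
          unfolding sum_distrib_left
          by (intro sum.cong refl) (simp only: minus_add_distrib diff_conv_add_uminus mult.left_commute)
        thus "(\<Sum>j\<in>{1..J}. ((- s) gchoose j) * ?a (s + of_nat j) n) + r J (Suc n) s =
              z ^ Suc n * (of_nat (Suc (Suc n)) powr (- s) - of_nat (Suc n) powr (- s))"
          by (simp only: shift_expansion[where J = J] r_def distrib_left)
      qed
      finally show ?thesis unfolding G_def by (subst abel[OF s, symmetric])
    qed
    ultimately show ?case unfolding J_def by (intro exI[of _ G]) auto
  qed
qed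

section \<open>Gluing along half-planes\<close>

text \<open>The functions given on two half-planes agree by the identity theorem. To compare them one only needs
the difference of the holomorphic parts and of the additional principal parts, which is holomorphic
on the smaller half-plane, since the additional poles lie to the left of it. Hence they agree even at
the poles, where the singular term has the value \<open>c / 0 = 0\<close> on both sides. In particular the glued
function is holomorphic at \<open>1/2 - m\<close> whenever \<open>c m = 0\<close>, and no singularity has to be removed afterwards.\<close>

lemma half_plane_gluing:
  fixes f :: "complex \<Rightarrow> complex" and c :: "nat \<Rightarrow> complex" and a :: real
  assumes a: "a \<ge> 0"
    and ex: "\<And>N. \<exists>H. H holomorphic_on {t. Re t > - real N} \<and>
       (\<forall>t. Re t > a \<longrightarrow> f t = H t + (\<Sum>m\<le>N. c m / (t - (1/2 - of_nat m))))"
  shows "\<exists>K. (\<forall>t. Re t > a \<longrightarrow> K t = f t) \<and>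
     (\<forall>N. \<exists>H. H holomorphic_on {t. Re t > - real N} \<and>
       (\<forall>t. Re t > - real N \<longrightarrow> K t = H t + (\<Sum>m\<le>N. c m / (t - (1/2 - of_nat m)))))"
proof -
  define p :: "nat \<Rightarrow> complex" where "p m = 1/2 - of_nat m" for m
  obtain H where H: "\<And>N. H N holomorphic_on {t. Re t > - real N}"
    "\<And>N t. Re t > a \<Longrightarrow> f t = H N t + (\<Sum>m\<le>N. c m / (t - p m))"
    using ex unfolding p_def by metis
  define L where "L N t = H N t + (\<Sum>m\<le>N. c m / (t - p m))" for N t
  have mono: "L N t = L M t" if NM: "N \<le> M" and t: "Re t > - real N" for N M t
  proof -
    let ?S = "{t. Re t > - real N}"
    \<comment> \<open>The additional poles have index \<open>m > N\<close>, hence real part at most \<open>- N - 1/2\<close>.\<close>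
    define D where "D t = H M t + (\<Sum>m\<in>{N<..M}. c m / (t - p m))" for t
    have M_split: "L M t = D t + (\<Sum>m\<le>N. c m / (t - p m))" for t
    proof -
      have "{..M} = {..N} \<union> {N<..M}" using NM by auto
      hence "(\<Sum>m\<le>M. c m / (t - p m)) = (\<Sum>m\<le>N. c m / (t - p m)) + (\<Sum>m\<in>{N<..M}. c m / (t - p m))"
        by (simp only:) (rule sum.union_disjoint, auto)
      thus ?thesis by (simp add: L_def D_def)
    qed
    have holo_D: "D holomorphic_on ?S"
    proof -
      have "H M holomorphic_on ?S"
        using NM by (intro holomorphic_on_subset[OF H(1)[of M]]) auto
      moreover have "t - p m \<noteq> 0" if "m \<in> {N<..M}" "t \<in> ?S" for m t
      proof
        assume "t - p m = 0"
        hence "Re (t - p m) = 0" by simp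
        thus False using that by (simp add: p_def)
      qed
      ultimately show ?thesis unfolding D_def[abs_def] by (intro holomorphic_intros) auto
    qed
    have "H N t = D t"
    proof (rule analytic_continuation_open[where s = "{t. Re t > a}" and s' = ?S and f = "H N" and g = D])
      show "open {t. Re t > a}" "open ?S" by (simp_all add: open_halfspace_Re_gt)
      have "complex_of_real (a + 1) \<in> {t. Re t > a}" by simp
      thus "{t. Re t > a} \<noteq> {}" by blast
      show "connected ?S" by (intro convex_connected convex_halfspace_Re_gt)
      show "{t. Re t > a} \<subseteq> ?S" using a by auto
      show "H N holomorphic_on ?S" "D holomorphic_on ?S" by (fact H holo_D)+
      show "H N z = D z" if "z \<in> {t. Re t > a}" for z
        using that H(2)[of z N] H(2)[of z M] M_split[of z] by (simp add: L_def)
      show "t \<in> ?S" using t by simp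
    qed
    thus ?thesis unfolding M_split by (simp add: L_def)
  qed
  define K where "K t = L (nat \<lceil>\<bar>Re t\<bar>\<rceil> + 1) t" for t
  have K_eq: "K t = L N t" if t: "Re t > - real N" for N t
  proof -
    define n where "n = nat \<lceil>\<bar>Re t\<bar>\<rceil> + 1"
    have n: "Re t > - real n" unfolding n_def by linarith
    have "L n t = L N t"
    proof (cases "n \<le> N")
      case True
      thus ?thesis by (rule mono[OF _ n])
    next
      case False
      hence "N \<le> n" by simp
      thus ?thesis by (rule mono[OF _ t, symmetric])
    qed
    thus ?thesis by (simp only: K_def n_def)
  qed
  show ?thesis
  proof (rule exI[of _ K], intro conjI allI impI)
    fix t assume t: "Re t > a"
    hence "Re t > - real 0" using a by simp
    thus "K t = f t" using H(2)[OF t, of 0] K_eq[of 0 t] by (simp add: L_def)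
  next
    fix N
    show "\<exists>H. H holomorphic_on {t. Re t > - real N} \<and>
       (\<forall>t. Re t > - real N \<longrightarrow> K t = H t + (\<Sum>m\<le>N. c m / (t - (1/2 - of_nat m))))"
      using H(1)[of N] K_eq unfolding L_def p_def by blast
  qed
qed

text \<open>Near \<open>p\<close> the function is \<open>g(t) / (t - p)\<close> with \<open>g(t) = G(t) (t - p) + c\<close> holomorphic and \<open>g(p) = c\<close>.\<close>

lemma holomorphic_plus_simple_pole:
  fixes K G :: "complex \<Rightarrow> complex"
  assumes U: "open U" "p \<in> U" and G: "G holomorphic_on U"
    and K: "\<And>t. t \<in> U \<Longrightarrow> K t = G t + c / (t - p)"
  shows simple_pole_meromorphic: "K meromorphic_on {p}"
    and simple_pole_residue: "residue K p = c"
    and simple_pole_is_simple_pole: "c \<noteq> 0 \<Longrightarrow> is_simple_pole K p"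
    and simple_pole_analytic: "c = 0 \<Longrightarrow> K analytic_on {p}"
proof -
  define g where "g t = G t * (t - p) + c" for t
  have g: "g holomorphic_on U" unfolding g_def[abs_def] by (intro holomorphic_intros G)
  have gp: "g p = c" by (simp add: g_def)
  have K_g: "K t = g t / (t - p)" if "t \<in> U" "t \<noteq> p" for t
    using that K[OF that(1)] by (simp add: g_def field_simps)
  have ev: "eventually (\<lambda>t. K t = g t / (t - p)) (at p)"
    using eventually_at_in_open[OF U] by eventually_elim (auto intro: K_g)
  have "g analytic_on {p}" using U g analytic_at by blast
  hence "(\<lambda>t. g t / (t - p)) meromorphic_on {p}"
    by (intro meromorphic_intros analytic_on_imp_meromorphic_on)
  thus "K meromorphic_on {p}"
    using ev by (subst meromorphic_on_cong[where g = "\<lambda>t. g t / (t - p)" and B = "{p}"]) auto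
  show "residue K p = c"
    using residue_cong[OF ev refl] residue_simple[OF U g] gp by simp
  show "is_simple_pole K p" if "c \<noteq> 0"
    unfolding is_simple_pole_def
  proof
    have "is_pole (\<lambda>t. g t / (t - p) ^ 1) p"
      using is_pole_basic[OF g U, of 1] that gp by simp
    thus "is_pole K p" using is_pole_cong[OF ev refl] by simp
    show "zorder K p = - 1"
      by (rule zorder_eqI[OF U g]) (use that gp K_g in \<open>auto simp: field_simps\<close>)
  qed
  show "K analytic_on {p}" if "c = 0"
  proof -
    have "K holomorphic_on U" using G K that by (subst holomorphic_cong[where g = G]) auto
    thus ?thesis using U analytic_at by blast
  qed
qed

text \<open>Around any point all but at most one of the principal parts are holomorphic, which reduces everything
to a holomorphic function plus a single simple pole.\<close>

lemma glued_function_properties: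
  fixes K :: "complex \<Rightarrow> complex" and c :: "nat \<Rightarrow> complex"
  assumes ex: "\<And>N. \<exists>H. H holomorphic_on {t. Re t > - real N} \<and>
       (\<forall>t. Re t > - real N \<longrightarrow> K t = H t + (\<Sum>m\<le>N. c m / (t - (1/2 - of_nat m))))"
  shows glued_meromorphic: "K meromorphic_on UNIV"
    and glued_residue: "residue K (1/2 - of_nat m) = c m"
    and glued_simple_pole: "c m \<noteq> 0 \<Longrightarrow> is_simple_pole K (1/2 - of_nat m)"
    and glued_analytic_at: "c m = 0 \<Longrightarrow> K analytic_on {1/2 - of_nat m}"
    and glued_analytic: "K analytic_on (UNIV - range (\<lambda>m::nat. 1/2 - of_nat m))"
proof -
  define p :: "nat \<Rightarrow> complex" where "p m = 1/2 - of_nat m" for m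
  have p_inj: "p k \<noteq> p m" if "k \<noteq> m" for k m using that by (simp add: p_def)
  have local: "\<exists>U G. open U \<and> t0 \<in> U \<and> G holomorphic_on U \<and>
      (\<forall>t\<in>U. K t = G t + (\<Sum>m | m \<le> N \<and> p m = t0. c m / (t - p m)))"
    if t0: "Re t0 > - real N" for t0 N
  proof -
    obtain H where H: "H holomorphic_on {t. Re t > - real N}"
      "\<And>t. Re t > - real N \<Longrightarrow> K t = H t + (\<Sum>m\<le>N. c m / (t - p m))"
      using ex[of N] unfolding p_def by blast
    define F where "F = {m. m \<le> N \<and> p m \<noteq> t0}"
    have F: "finite F" unfolding F_def by auto
    define U where "U = {t. Re t > - real N} - p ` F"
    define G where "G t = H t + (\<Sum>m\<in>F. c m / (t - p m))" for t
    have "open U" unfolding U_def using F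
      by (intro open_Diff open_halfspace_Re_gt finite_imp_closed finite_imageI)
    moreover have "t0 \<in> U" using t0 by (auto simp: U_def F_def)
    moreover have "G holomorphic_on U"
      unfolding G_def[abs_def]
      by (intro holomorphic_intros holomorphic_on_subset[OF H(1)]) (auto simp: U_def)
    moreover have "K t = G t + (\<Sum>m | m \<le> N \<and> p m = t0. c m / (t - p m))" if "t \<in> U" for t
    proof -
      have "{..N} = F \<union> {m. m \<le> N \<and> p m = t0}" by (auto simp: F_def)
      hence "(\<Sum>m\<le>N. c m / (t - p m)) = (\<Sum>m\<in>F. c m / (t - p m)) + (\<Sum>m | m \<le> N \<and> p m = t0. c m / (t - p m))"
        using F by (simp only:) (rule sum.union_disjoint, auto simp: F_def)
      thus ?thesis using H(2)[of t] that by (simp add: U_def G_def)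
    qed
    ultimately show ?thesis by blast
  qed
  have at_pole: "\<exists>U G. open U \<and> p m \<in> U \<and> G holomorphic_on U \<and> (\<forall>t\<in>U. K t = G t + c m / (t - p m))" for m
  proof -
    have eq: "{k. k \<le> m \<and> p k = p m} = {m}" using p_inj by auto
    have "Re (p m) > - real m" by (simp add: p_def)
    from local[OF this] show ?thesis unfolding eq by simp
  qed
  have off_pole: "K analytic_on {t0}" if "t0 \<notin> range p" for t0
  proof -
    obtain N :: nat where N: "- Re t0 < real N" using reals_Archimedean2 by blast
    have eq: "{k. k \<le> N \<and> p k = t0} = {}" using that by auto
    have "Re t0 > - real N" using N by simp
    from local[OF this] obtain U G where UG: "open U" "t0 \<in> U" "G holomorphic_on U" "\<And>t. t \<in> U \<Longrightarrow> K t = G t"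
      unfolding eq by auto
    have "K holomorphic_on U" using UG(3,4) by (subst holomorphic_cong[where g = G]) auto
    thus ?thesis using UG analytic_at by blast
  qed
  obtain U G where UG: "open U" "p m \<in> U" "G holomorphic_on U" "\<And>t. t \<in> U \<Longrightarrow> K t = G t + c m / (t - p m)"
    using at_pole[of m] by blast
  show "residue K (1/2 - of_nat m) = c m"
    using simple_pole_residue[OF UG] by (simp add: p_def)
  show "is_simple_pole K (1/2 - of_nat m)" if "c m \<noteq> 0"
    using simple_pole_is_simple_pole[OF UG that] by (simp add: p_def)
  show "K analytic_on {1/2 - of_nat m}" if "c m = 0"
    using simple_pole_analytic[OF UG that] by (simp add: p_def)
  show "K analytic_on (UNIV - range (\<lambda>m::nat. 1/2 - of_nat m))"
    by (subst analytic_on_analytic_at) (use off_pole in \<open>auto simp: p_def[abs_def]\<close>)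
  show "K meromorphic_on UNIV"
  proof (subst meromorphic_on_meromorphic_at, intro ballI)
    fix t0
    show "K meromorphic_on {t0}"
    proof (cases "t0 \<in> range p")
      case True
      then obtain k where k: "t0 = p k" by blast
      obtain U G where "open U" "p k \<in> U" "G holomorphic_on U" "\<And>t. t \<in> U \<Longrightarrow> K t = G t + c k / (t - p k)"
        using at_pole[of k] by blast
      thus ?thesis unfolding k by (rule simple_pole_meromorphic)
    next
      case False
      thus ?thesis using off_pole analytic_on_imp_meromorphic_on by blast
    qed
  qed
qed

section \<open>The series of the kernel\<close>

definition lam_exp :: "nat \<Rightarrow> complex \<Rightarrow> complex" where
  "lam_exp n t = exp (- 2 * of_real (lam n) * t)"

definition lam_const :: complex where
  "lam_const = of_real (4 * ln 2 + 2 * euler_mascheroni)"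

abbreviation p_S1 :: "nat \<Rightarrow> complex \<Rightarrow> complex" where
  "p_S1 j \<equiv> p_poly j (\<lambda>k. complex_of_real (S1 k))"

definition lam_rem :: "nat \<Rightarrow> nat \<Rightarrow> complex \<Rightarrow> complex" where
  "lam_rem J n t = lam_exp n t - exp (- lam_const * t) * (\<Sum>j\<le>J. p_S1 j t * of_nat n powr (- (2 * t + of_nat j)))"

lemma holomorphic_p_S1: "f holomorphic_on A \<Longrightarrow> (\<lambda>t. p_S1 j (f t)) holomorphic_on A"
  unfolding p_poly_def by (intro holomorphic_intros)

lemma p_S1_odd: "odd j \<Longrightarrow> p_S1 j t = 0"
  by (rule p_poly_odd) (simp_all add: S1_odd)

text \<open>Expanding up to the order \<open>J = 2 N\<close> leaves terms of the order \<open>n\<^bsup>- 2 Re t - 2 N - 1\<^esup>\<close>, which are summable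
exactly for \<open>Re t > - N\<close>.\<close>

lemma lam_rem_series:
  assumes z: "norm z = 1"
  shows lam_rem_series_holomorphic: "(\<lambda>t. \<Sum>n. z ^ Suc n * lam_rem (2 * N) (Suc n) t) holomorphic_on {t. Re t > - real N}"
    and lam_rem_series_summable: "Re t > - real N \<Longrightarrow> summable (\<lambda>n. z ^ Suc n * lam_rem (2 * N) (Suc n) t)"
proof -
  define f where "f n t = z ^ n * lam_rem (2 * N) n t" for n t
  have holo: "f (Suc n) holomorphic_on UNIV" for n
    unfolding f_def[abs_def] lam_rem_def lam_exp_def by (intro holomorphic_intros holomorphic_p_S1)
  have bound: "\<exists>C. \<forall>n\<ge>2. \<forall>t. norm t \<le> R \<longrightarrow> norm (f n t) \<le> C * real n powr (- 2 * Re t - (2 * real N + 1))" for R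
  proof -
    obtain C where C: "\<And>n t. n \<ge> 1 \<Longrightarrow> norm t \<le> R \<Longrightarrow>
      norm (exp (- 2 * of_real (lam n) * t) - exp (- of_real (4 * ln 2 + 2 * euler_mascheroni) * t) *
        (\<Sum>j\<le>2*N. p_S1 j t * of_nat n powr (- 2 * t - of_nat j)))
      \<le> C * real n powr (- 2 * Re t - real (2*N) - 1)"
      using exp_lam_expansion[of R "2*N"] by blast
    show ?thesis
    proof (intro exI[of _ C] allI impI)
      fix n :: nat and t :: complex assume n: "n \<ge> 2" and t: "norm t \<le> R"
      have "norm (f n t) = norm (lam_rem (2*N) n t)" by (simp add: f_def norm_mult norm_power z)
      also have "\<dots> \<le> C * real n powr (- 2 * Re t - real (2*N) - 1)"
        using C[of n t] n t by (simp add: lam_rem_def lam_exp_def lam_const_def)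
      finally show "norm (f n t) \<le> C * real n powr (- 2 * Re t - (2 * real N + 1))"
        by (simp add: diff_diff_eq)
    qed
  qed
  have set_eq: "{t. Re t > - real N} = {t. 2 * Re t + (2 * real N + 1) > 1}" by auto
  show "(\<lambda>t. \<Sum>n. z ^ Suc n * lam_rem (2 * N) (Suc n) t) holomorphic_on {t. Re t > - real N}"
    using half_plane_series_holomorphic[where f = f and \<kappa> = 2 and b = "2 * real N + 1", OF holo _ bound]
    unfolding set_eq f_def by (simp only: zero_less_numeral)
  show "summable (\<lambda>n. z ^ Suc n * lam_rem (2 * N) (Suc n) t)" if "Re t > - real N"
    using half_plane_series_summable[where f = f and \<kappa> = 2 and b = "2 * real N + 1", OF holo _ bound, of t] that
    unfolding f_def by simp
qed

lemma lam_exp_split: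
  "z ^ Suc n * lam_exp (Suc n) t = exp (- lam_const * t) *
     (\<Sum>j\<le>J. p_S1 j t * (z ^ Suc n * of_nat (Suc n) powr (- (2 * t + of_nat j)))) + z ^ Suc n * lam_rem J (Suc n) t"
proof -
  have "(\<Sum>j\<le>J. p_S1 j t * (z ^ Suc n * of_nat (Suc n) powr (- (2 * t + of_nat j))))
     = z ^ Suc n * (\<Sum>j\<le>J. p_S1 j t * of_nat (Suc n) powr (- (2 * t + of_nat j)))"
    unfolding sum_distrib_left by (intro sum.cong refl) (simp only: mult.left_commute)
  thus ?thesis unfolding lam_rem_def by (simp only: right_diff_distrib) (simp only: mult.left_commute, simp)
qed

text \<open>Each power in the expansion contributes a value \<open>P(2 t + j)\<close> of the function that continues
\<open>\<Sum>n. z\<^sup>n n\<^bsup>-s\<^esup>\<close>.\<close>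

lemma twisted_lam_series:
  assumes z: "norm z = 1" "z \<noteq> 1"
  shows "\<exists>H. H holomorphic_on {t. Re t > - real N} \<and>
     (\<forall>t. Re t > 0 \<longrightarrow> (\<lambda>n. z ^ Suc n * lam_exp (Suc n) t) sums H t)"
proof -
  obtain P where P: "P holomorphic_on {s. Re s > - real (2 * N)}"
    "\<And>s. Re s > 0 \<Longrightarrow> (\<lambda>n. z ^ Suc n * of_nat (Suc n) powr (- s)) sums P s"
    using polylog_continuation[OF z, of "2 * N"] by blast
  define H where "H t = exp (- lam_const * t) * (\<Sum>j\<le>2*N. p_S1 j t * P (2 * t + of_nat j))
      + (\<Sum>n. z ^ Suc n * lam_rem (2 * N) (Suc n) t)" for t
  have "(\<lambda>t. P (2 * t + of_nat j)) holomorphic_on {t. Re t > - real N}" for j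
  proof (rule holomorphic_on_compose_gen[unfolded o_def, OF _ P(1)])
    show "(\<lambda>t. 2 * t + of_nat j) holomorphic_on {t. Re t > - real N}" by (intro holomorphic_intros)
  qed auto
  hence "H holomorphic_on {t. Re t > - real N}"
    unfolding H_def[abs_def]
    by (intro holomorphic_intros holomorphic_p_S1 lam_rem_series_holomorphic z(1))
  moreover have "(\<lambda>n. z ^ Suc n * lam_exp (Suc n) t) sums H t" if "Re t > 0" for t
    unfolding H_def lam_exp_split[where J = "2 * N"] using that
    by (intro sums_add sums_mult sums_sum P(2) summable_sums lam_rem_series_summable z(1)) auto
  ultimately show ?thesis by blast
qed

text \<open>The value at \<open>t = 1/2 - m\<close> of the coefficient of \<open>n\<^bsup>- 2 t - 2 m\<^esup>\<close>; the factor \<open>1/2\<close> is the residue of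
\<open>\<zeta>(2 t + 2 m)\<close>.\<close>

definition lam_residue :: "nat \<Rightarrow> complex" where
  "lam_residue m = exp (- lam_const * (1/2 - of_nat m)) * p_S1 (2 * m) (1/2 - of_nat m) / 2"

text \<open>Each power in the expansion contributes \<open>p\<^sub>j(t) \<zeta>(2 t + j)\<close> up to the exponential factor, with a possible
pole at \<open>t = (1 - j)/2\<close>. The terms with odd \<open>j\<close> vanish identically. For \<open>j = 2 m\<close> the contribution is
\<open>A(t) / (t - p\<^sub>m)\<close> with \<open>p\<^sub>m = 1/2 - m\<close> and \<open>A\<close> holomorphic, and splitting off \<open>A(p\<^sub>m) / (t - p\<^sub>m)\<close>
leaves a difference quotient, which is holomorphic.\<close>

lemma lam_series:
  "\<exists>H. H holomorphic_on {t. Re t > - real N} \<and>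
     (\<forall>t. Re t > 1/2 \<longrightarrow> (\<lambda>n. lam_exp (Suc n) t) sums (H t + (\<Sum>m\<le>N. lam_residue m / (t - (1/2 - of_nat m)))))"
proof -
  let ?S = "{t. Re t > - real N}"
  define p :: "nat \<Rightarrow> complex" where "p m = 1/2 - of_nat m" for m
  obtain Z where Z: "Z holomorphic_on {s. Re s > 1 - real (2 * N + 1)}" "Z 1 = 1"
    "\<And>s. Re s > 1 \<Longrightarrow> (\<lambda>n. of_nat (Suc n) powr (- s)) sums (Z s / (s - 1))"
    using zeta_continuation[of "2 * N + 1"] by auto
  define A where "A m t = exp (- lam_const * t) * p_S1 (2 * m) t * Z (2 * t + of_nat (2 * m)) / 2" for m t
  \<comment> \<open>The difference quotient, with its removable singularity filled.\<close>
  define B where "B m t = (if t = p m then deriv (A m) (p m) else (A m t - A m (p m)) / (t - p m))" for m t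
  have A_p: "A m (p m) = lam_residue m" for m
    by (simp add: A_def lam_residue_def p_def Z(2))
  have "(\<lambda>t. Z (2 * t + of_nat (2 * m))) holomorphic_on ?S" for m
  proof (rule holomorphic_on_compose_gen[unfolded o_def, OF _ Z(1)])
    show "(\<lambda>t. 2 * t + of_nat (2 * m)) holomorphic_on ?S" by (intro holomorphic_intros)
  qed auto
  hence A: "A m holomorphic_on ?S" for m
    unfolding A_def[abs_def] by (intro holomorphic_intros holomorphic_p_S1) auto
  have B: "B m holomorphic_on ?S" for m
    unfolding B_def[abs_def] by (rule pole_lemma_open[OF A]) (simp add: open_halfspace_Re_gt)
  define H where "H t = (\<Sum>m\<le>N. B m t) + (\<Sum>n. 1 ^ Suc n * lam_rem (2 * N) (Suc n) t)" for t
  have "H holomorphic_on ?S"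
    unfolding H_def[abs_def] by (intro holomorphic_intros B lam_rem_series_holomorphic) simp
  moreover have "(\<lambda>n. lam_exp (Suc n) t) sums (H t + (\<Sum>m\<le>N. lam_residue m / (t - p m)))" if t: "Re t > 1/2" for t
  proof -
    let ?T = "\<lambda>j. p_S1 j t * (Z (2 * t + of_nat j) / (2 * t + of_nat j - 1))"
    have Z1: "(\<lambda>n. 1 ^ Suc n * of_nat (Suc n) powr (- s)) sums (Z s / (s - 1))" if "Re s > 1" for s
      unfolding power_one mult_1 by (rule Z(3)[OF that])
    have "(\<lambda>n. 1 ^ Suc n * lam_exp (Suc n) t) sums
        (exp (- lam_const * t) * (\<Sum>j\<le>2*N. ?T j) + (\<Sum>n. 1 ^ Suc n * lam_rem (2 * N) (Suc n) t))"
      unfolding lam_exp_split[where J = "2 * N" and z = 1] using t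
      by (intro sums_add sums_mult sums_sum Z1 summable_sums lam_rem_series_summable) auto
    also have "(\<Sum>j\<le>2*N. ?T j) = (\<Sum>j\<in>(\<lambda>m. 2 * m) ` {..N}. ?T j)"
    proof (rule sum.mono_neutral_right)
      show "\<forall>j\<in>{..2 * N} - (\<lambda>m. 2 * m) ` {..N}. ?T j = 0"
      proof
        fix j assume j: "j \<in> {..2 * N} - (\<lambda>m. 2 * m) ` {..N}"
        hence "odd j" by (auto elim!: evenE)
        thus "?T j = 0" by (simp add: p_S1_odd)
      qed
    qed auto
    also have "\<dots> = (\<Sum>m\<le>N. ?T (2 * m))" by (subst sum.reindex) (auto simp: inj_on_def)
    also have "exp (- lam_const * t) * (\<Sum>m\<le>N. ?T (2 * m)) = (\<Sum>m\<le>N. B m t + lam_residue m / (t - p m))"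
      unfolding sum_distrib_left
    proof (rule sum.cong[OF refl])
      fix m
      have ne: "t - p m \<noteq> 0"
      proof
        assume "t - p m = 0"
        hence "Re (t - p m) = 0" by simp
        thus False using t by (simp add: p_def)
      qed
      have e: "2 * t + of_nat (2 * m) - 1 = 2 * (t - p m)" by (simp add: p_def algebra_simps)
      have "exp (- lam_const * t) * ?T (2 * m) = A m t / (t - p m)"
        unfolding A_def e by (simp only: times_divide_eq_right divide_divide_eq_left mult.assoc)
      also have "\<dots> = B m t + lam_residue m / (t - p m)"
        using ne by (simp add: B_def A_p[symmetric] diff_divide_distrib)
      finally show "exp (- lam_const * t) * ?T (2 * m) = B m t + lam_residue m / (t - p m)" .
    qed
    finally show ?thesis by (simp add: H_def sum.distrib algebra_simps)
  qed
  ultimately show ?thesis unfolding p_def by blast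
qed

section \<open>The kernel on and off the diagonal\<close>

lemma K1_term_pos: "K1_term t \<phi> \<theta> (int (Suc n)) = exp (\<i> * of_real (\<phi> - \<theta>)) ^ Suc n * lam_exp (Suc n) t"
proof -
  have "exp (\<i> * of_int (int (Suc n)) * of_real (\<phi> - \<theta>)) = exp (of_nat (Suc n) * (\<i> * of_real (\<phi> - \<theta>)))"
    by (simp only: of_int_of_nat_eq mult_ac)
  also have "\<dots> = exp (\<i> * of_real (\<phi> - \<theta>)) ^ Suc n" by (rule exp_of_nat_mult)
  finally show ?thesis by (simp only: K1_term_def lam_exp_def abs_minus_cancel abs_of_nat nat_int)
qed

lemma K1_term_neg: "K1_term t \<phi> \<theta> (- int (Suc n)) = exp (- \<i> * of_real (\<phi> - \<theta>)) ^ Suc n * lam_exp (Suc n) t"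
proof -
  have "exp (\<i> * of_int (- int (Suc n)) * of_real (\<phi> - \<theta>)) = exp (of_nat (Suc n) * (- \<i> * of_real (\<phi> - \<theta>)))"
    by (simp only: of_int_minus of_int_of_nat_eq mult_minus_left mult_minus_right mult_ac)
  also have "\<dots> = exp (- \<i> * of_real (\<phi> - \<theta>)) ^ Suc n" by (rule exp_of_nat_mult)
  finally show ?thesis by (simp only: K1_term_def lam_exp_def abs_minus_cancel abs_of_nat nat_int)
qed

lemma exp_i_neq_1:
  fixes x :: real
  assumes "x \<noteq> 0" "\<bar>x\<bar> < 2 * pi"
  shows "exp (\<i> * of_real x) \<noteq> 1"
proof
  assume "exp (\<i> * of_real x) = 1"
  then obtain n :: int where n: "x = of_int (2 * n) * pi" by (auto simp: exp_eq_1)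
  have "n \<noteq> 0" using n assms by auto
  hence "\<bar>real_of_int n\<bar> \<ge> 1" by linarith
  hence "2 * pi * \<bar>real_of_int n\<bar> \<ge> 2 * pi * 1" by (intro mult_left_mono) auto
  thus False using n assms by (simp add: abs_mult)
qed

lemma K1_off_diagonal:
  assumes "\<phi> \<in> {0..<2 * pi}" "\<theta> \<in> {0..<2 * pi}" "\<phi> \<noteq> \<theta>"
  shows K1_off_diagonal_convergent: "Re t > 0 \<Longrightarrow> K1_convergent t \<phi> \<theta>"
    and K1_off_diagonal_continuation:
      "\<exists>K. K holomorphic_on UNIV \<and> (\<forall>t. Re t > 0 \<longrightarrow> K t = K1 t \<phi> \<theta>)"
proof -
  let ?z = "exp (\<i> * of_real (\<phi> - \<theta>))" and ?w = "exp (- \<i> * of_real (\<phi> - \<theta>))"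
  have lt: "\<bar>\<phi> - \<theta>\<bar> < 2 * pi" using assms by (auto simp: abs_less_iff)
  hence z: "norm ?z = 1" "?z \<noteq> 1" using exp_i_neq_1[of "\<phi> - \<theta>"] assms by auto
  have w: "norm ?w = 1" "?w \<noteq> 1" using exp_i_neq_1[of "\<theta> - \<phi>"] lt assms by (auto simp: abs_minus_commute algebra_simps)
  note z_series = twisted_lam_series[OF z] and w_series = twisted_lam_series[OF w]
  show "K1_convergent t \<phi> \<theta>" if "Re t > 0"
    unfolding K1_convergent_def K1_term_pos K1_term_neg
    using z_series[of 0] w_series[of 0] that by (blast intro: sums_summable)
  have "\<exists>H. H holomorphic_on {t. Re t > - real N} \<and>
       (\<forall>t. Re t > 0 \<longrightarrow> K1 t \<phi> \<theta> = H t + (\<Sum>m\<le>N. 0 / (t - (1/2 - of_nat m))))" for N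
  proof -
    obtain H1 where H1: "H1 holomorphic_on {t. Re t > - real N}"
      "\<And>t. Re t > 0 \<Longrightarrow> (\<lambda>n. ?z ^ Suc n * lam_exp (Suc n) t) sums H1 t" using z_series[of N] by blast
    obtain H2 where H2: "H2 holomorphic_on {t. Re t > - real N}"
      "\<And>t. Re t > 0 \<Longrightarrow> (\<lambda>n. ?w ^ Suc n * lam_exp (Suc n) t) sums H2 t" using w_series[of N] by blast
    define H where "H t = 1 / (2 * of_real pi) + 1 / (2 * of_real pi) * (H1 t + H2 t)" for t
    have "H holomorphic_on {t. Re t > - real N}"
      unfolding H_def[abs_def] by (intro holomorphic_intros H1 H2) auto
    moreover have "K1 t \<phi> \<theta> = H t" if "Re t > 0" for t
      unfolding K1_def H_def K1_term_pos K1_term_neg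
      using sums_unique[OF H1(2)[OF that]] sums_unique[OF H2(2)[OF that]] by simp
    ultimately show ?thesis by (intro exI[of _ H]) simp
  qed
  from half_plane_gluing[OF order.refl this] obtain K where K: "\<And>t. Re t > 0 \<Longrightarrow> K t = K1 t \<phi> \<theta>"
    "\<And>N. \<exists>H. H holomorphic_on {t. Re t > - real N} \<and>
       (\<forall>t. Re t > - real N \<longrightarrow> K t = H t + (\<Sum>m\<le>N. 0 / (t - (1/2 - of_nat m))))" by blast
  have "K analytic_on UNIV"
  proof (subst analytic_on_analytic_at, intro ballI)
    fix t0
    show "K analytic_on {t0}"
    proof (cases "t0 \<in> range (\<lambda>m::nat. 1/2 - of_nat m)")
      case True
      then obtain m :: nat where "t0 = 1/2 - of_nat m" by blast
      thus ?thesis using glued_analytic_at[OF K(2), of m] by simp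
    next
      case False
      thus ?thesis by (intro analytic_on_subset[OF glued_analytic[OF K(2)]]) simp
    qed
  qed
  thus "\<exists>K. K holomorphic_on UNIV \<and> (\<forall>t. Re t > 0 \<longrightarrow> K t = K1 t \<phi> \<theta>)"
    using K(1) analytic_imp_holomorphic by blast
qed

definition K1_residue :: "nat \<Rightarrow> real" where
  "K1_residue m = exp (- 2 * ln 2 - euler_mascheroni) / (2 * pi) *
     exp ((4 * ln 2 + 2 * euler_mascheroni) * real m) * p_poly (2 * m) S1 (1 / 2 - real m)"

text \<open>The factor \<open>1 / \<pi>\<close> is twice \<open>1 / (2 \<pi>)\<close>: on the diagonal the positive and the negative integers
contribute equally.\<close>

lemma K1_residue_eq: "1 / of_real pi * lam_residue m = of_real (K1_residue m)"
proof -
  define c :: real where "c = 4 * ln 2 + 2 * euler_mascheroni"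
  have "p_S1 (2 * m) (1/2 - of_nat m) = p_S1 (2 * m) (of_real (1/2 - real m))" by simp
  also have "\<dots> = of_real (p_poly (2 * m) S1 (1/2 - real m))" by (rule p_poly_of_real)
  finally have p: "p_S1 (2 * m) (1/2 - of_nat m) = of_real (p_poly (2 * m) S1 (1/2 - real m))" .
  have "exp (- lam_const * (1/2 - of_nat m)) = exp (of_real (- c * (1/2 - real m)))"
    by (simp add: lam_const_def c_def)
  also have "\<dots> = of_real (exp (- c * (1/2 - real m)))" by (rule exp_of_real)
  also have "exp (- c * (1/2 - real m)) = exp (- 2 * ln 2 - euler_mascheroni) * exp (c * real m)"
    by (subst exp_add[symmetric]) (simp add: c_def algebra_simps)
  finally show ?thesis unfolding lam_residue_def p K1_residue_def c_def by simp
qed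

lemma K1_residue_0: "K1_residue 0 \<noteq> 0"
  by (simp add: K1_residue_def p_poly_0)

lemma K1_diagonal:
  shows K1_diagonal_convergent: "Re t > 1/2 \<Longrightarrow> K1_convergent t \<phi> \<phi>"
    and K1_diagonal_continuation: "\<exists>K. (\<forall>t. Re t > 1/2 \<longrightarrow> K t = K1 t \<phi> \<phi>) \<and>
     (\<forall>N. \<exists>H. H holomorphic_on {t. Re t > - real N} \<and>
       (\<forall>t. Re t > - real N \<longrightarrow> K t = H t + (\<Sum>m\<le>N. of_real (K1_residue m) / (t - (1/2 - of_nat m)))))"
proof -
  have pos: "K1_term t \<phi> \<phi> (int (Suc n)) = lam_exp (Suc n) t" for t n
    unfolding K1_term_pos by simp
  have neg: "K1_term t \<phi> \<phi> (- int (Suc n)) = lam_exp (Suc n) t" for t n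
    unfolding K1_term_neg by simp
  show "K1_convergent t \<phi> \<phi>" if "Re t > 1/2"
    unfolding K1_convergent_def pos neg using lam_series[of 0] that by (blast intro: sums_summable)
  have "\<exists>H. H holomorphic_on {t. Re t > - real N} \<and>
       (\<forall>t. Re t > 1/2 \<longrightarrow> K1 t \<phi> \<phi> = H t + (\<Sum>m\<le>N. of_real (K1_residue m) / (t - (1/2 - of_nat m))))" for N
  proof -
    obtain H1 where H1: "H1 holomorphic_on {t. Re t > - real N}"
      "\<And>t. Re t > 1/2 \<Longrightarrow> (\<lambda>n. lam_exp (Suc n) t) sums (H1 t + (\<Sum>m\<le>N. lam_residue m / (t - (1/2 - of_nat m))))"
      using lam_series[of N] by blast
    define H where "H t = 1 / (2 * of_real pi) + 1 / of_real pi * H1 t" for t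
    have "H holomorphic_on {t. Re t > - real N}"
      unfolding H_def[abs_def] by (intro holomorphic_intros H1) auto
    moreover have "K1 t \<phi> \<phi> = H t + (\<Sum>m\<le>N. of_real (K1_residue m) / (t - (1/2 - of_nat m)))" if "Re t > 1/2" for t
    proof -
      have "K1 t \<phi> \<phi> = 1 / (2 * of_real pi) + 1 / of_real pi * (H1 t + (\<Sum>m\<le>N. lam_residue m / (t - (1/2 - of_nat m))))"
        unfolding K1_def pos neg sums_unique[OF H1(2)[OF that], symmetric] by (simp add: field_simps)
      also have "\<dots> = H t + (\<Sum>m\<le>N. 1 / of_real pi * lam_residue m / (t - (1/2 - of_nat m)))"
        by (simp only: H_def distrib_left sum_distrib_left times_divide_eq_right add.assoc)
      finally show ?thesis unfolding K1_residue_eq .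
    qed
    ultimately show ?thesis by blast
  qed
  thus "\<exists>K. (\<forall>t. Re t > 1/2 \<longrightarrow> K t = K1 t \<phi> \<phi>) \<and>
     (\<forall>N. \<exists>H. H holomorphic_on {t. Re t > - real N} \<and>
       (\<forall>t. Re t > - real N \<longrightarrow> K t = H t + (\<Sum>m\<le>N. of_real (K1_residue m) / (t - (1/2 - of_nat m)))))"
    by (intro half_plane_gluing) auto
qed

theorem theorem1p2:
  shows
    "(\<forall>\<phi>\<in>{0..<2 * pi}. \<forall>\<theta>\<in>{0..<2 * pi}. \<forall>t.
        (if \<phi> = \<theta> then Re t > 1 / 2 else Re t > 0) \<longrightarrow> K1_convergent t \<phi> \<theta>) \<and>
     (\<forall>k\<ge>1. S1 k = - (2 / real k) * bernoulli_poly k (1 / 2)) \<and>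
     (\<exists>K :: real \<Rightarrow> real \<Rightarrow> complex \<Rightarrow> complex.
        (\<forall>\<phi>\<in>{0..<2 * pi}. \<forall>\<theta>\<in>{0..<2 * pi}. \<phi> \<noteq> \<theta> \<longrightarrow>
           K \<phi> \<theta> holomorphic_on UNIV \<and>
           (\<forall>t. Re t > 0 \<longrightarrow> K \<phi> \<theta> t = K1 t \<phi> \<theta>)) \<and>
        (\<forall>\<phi>\<in>{0..<2 * pi}.
           K \<phi> \<phi> meromorphic_on UNIV \<and>
           (\<forall>t. Re t > 1 / 2 \<longrightarrow> K \<phi> \<phi> t = K1 t \<phi> \<phi>) \<and>
           is_simple_pole (K \<phi> \<phi>) (1 / 2) \<and>
           (\<forall>m::nat. m \<ge> 1 \<longrightarrow>
              is_simple_pole (K \<phi> \<phi>) (1 / 2 - of_nat m) \<or>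
              K \<phi> \<phi> analytic_on {1 / 2 - of_nat m}) \<and>
           K \<phi> \<phi> analytic_on (UNIV - range (\<lambda>m::nat. 1 / 2 - of_nat m)) \<and>
           (\<forall>m::nat. residue (K \<phi> \<phi>) (1 / 2 - of_nat m) =
              of_real (exp (- 2 * ln 2 - euler_mascheroni) / (2 * pi) *
                exp ((4 * ln 2 + 2 * euler_mascheroni) * real m) *
                p_poly (2 * m) S1 (1 / 2 - real m)))) \<and>
        (\<forall>\<phi>\<in>{0..<2 * pi}. \<forall>\<theta>\<in>{0..<2 * pi}. K \<phi> \<theta> analytic_on {0}))"
proof -
  let ?I = "{0..<2 * pi}"
  define off where "off \<phi> \<theta> K \<longleftrightarrow> K holomorphic_on UNIV \<and> (\<forall>t. Re t > 0 \<longrightarrow> K t = K1 t \<phi> \<theta>)" for \<phi> \<theta> K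
  define diag where "diag \<phi> K \<longleftrightarrow> (\<forall>t. Re t > 1/2 \<longrightarrow> K t = K1 t \<phi> \<phi>) \<and>
     (\<forall>N. \<exists>H. H holomorphic_on {t. Re t > - real N} \<and>
       (\<forall>t. Re t > - real N \<longrightarrow> K t = H t + (\<Sum>m\<le>N. of_real (K1_residue m) / (t - (1/2 - of_nat m)))))" for \<phi> K
  define K where "K \<phi> \<theta> = (if \<phi> = \<theta> then SOME K. diag \<phi> K else SOME K. off \<phi> \<theta> K)" for \<phi> \<theta>
  have off: "K \<phi> \<theta> holomorphic_on UNIV" "Re t > 0 \<Longrightarrow> K \<phi> \<theta> t = K1 t \<phi> \<theta>"
    if "\<phi> \<in> ?I" "\<theta> \<in> ?I" "\<phi> \<noteq> \<theta>" for \<phi> \<theta> t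
  proof -
    have "\<exists>K. off \<phi> \<theta> K" unfolding off_def by (rule K1_off_diagonal_continuation[OF that])
    hence "off \<phi> \<theta> (K \<phi> \<theta>)" using that unfolding K_def by (simp add: someI_ex)
    thus "K \<phi> \<theta> holomorphic_on UNIV" "Re t > 0 \<Longrightarrow> K \<phi> \<theta> t = K1 t \<phi> \<theta>" unfolding off_def by auto
  qed
  have diag: "diag \<phi> (K \<phi> \<phi>)" for \<phi>
  proof -
    have "\<exists>K. diag \<phi> K" unfolding diag_def by (rule K1_diagonal_continuation)
    thus ?thesis unfolding K_def by (simp add: someI_ex)
  qed
  hence local: "\<exists>H. H holomorphic_on {t. Re t > - real N} \<and>
       (\<forall>t. Re t > - real N \<longrightarrow> K \<phi> \<phi> t = H t + (\<Sum>m\<le>N. of_real (K1_residue m) / (t - (1/2 - of_nat m))))" for \<phi> N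
    unfolding diag_def by blast
  have zero: "K \<phi> \<theta> analytic_on {0}" if "\<phi> \<in> ?I" "\<theta> \<in> ?I" for \<phi> \<theta>
  proof (cases "\<phi> = \<theta>")
    case True
    have "(0::complex) \<notin> range (\<lambda>m::nat. 1/2 - of_nat m)"
    proof
      assume "(0::complex) \<in> range (\<lambda>m::nat. 1/2 - of_nat m)"
      then obtain m :: nat where "(0::complex) = 1/2 - of_nat m" by blast
      hence "Re 0 = Re (1/2 - of_nat m)" by (rule arg_cong)
      hence "real (2 * m) = real 1" by simp
      hence "2 * m = 1" by (simp only: of_nat_eq_iff)
      thus False by presburger
    qed
    hence "K \<theta> \<theta> analytic_on {0}" by (intro analytic_on_subset[OF glued_analytic[OF local]]) auto
    thus ?thesis using True by simp
  next
    case False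
    have "K \<phi> \<theta> analytic_on UNIV" using off(1)[OF that False] by (simp add: analytic_on_open)
    thus ?thesis by (rule analytic_on_subset) simp
  qed
  show ?thesis
  proof (intro conjI exI[of _ K] ballI allI impI)
    fix \<phi> \<theta> t assume "\<phi> \<in> ?I" "\<theta> \<in> ?I" "if \<phi> = \<theta> then Re t > 1 / 2 else Re t > 0"
    thus "K1_convergent t \<phi> \<theta>"
      by (cases "\<phi> = \<theta>") (auto intro: K1_diagonal_convergent K1_off_diagonal_convergent)
  next
    fix \<phi> :: real
    show "is_simple_pole (K \<phi> \<phi>) (1 / 2)"
      using glued_simple_pole[OF local, where m = 0] K1_residue_0 by simp
    show "is_simple_pole (K \<phi> \<phi>) (1 / 2 - of_nat m) \<or> K \<phi> \<phi> analytic_on {1 / 2 - of_nat m}" for m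
      using glued_simple_pole[OF local, where m = m] glued_analytic_at[OF local, where m = m] by blast
    show "residue (K \<phi> \<phi>) (1 / 2 - of_nat m) =
              of_real (exp (- 2 * ln 2 - euler_mascheroni) / (2 * pi) *
                exp ((4 * ln 2 + 2 * euler_mascheroni) * real m) *
                p_poly (2 * m) S1 (1 / 2 - real m))" for m
      using glued_residue[OF local, where m = m] unfolding K1_residue_def .
    show "K \<phi> \<phi> t = K1 t \<phi> \<phi>" if "Re t > 1 / 2" for t
      using diag[of \<phi>] that unfolding diag_def by blast
  qed (use off zero glued_meromorphic[OF local] glued_analytic[OF local] in \<open>auto simp: S1_eq\<close>)
qed

end
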